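(* Let $(X_k)_{k\ge1}$ be a stationary ergodic sequence of $\mathbb{R}^d$-valued random variables with common law $\mu$, with $\Vert X_k\Vert\le A$ almost surely for all $k$, satisfying the Devroye inequality. Let $u:\mathbb{R}^d\to\mathbb{R}$ be a Hölder continuous function with $\int u\,d\mu=0$. Assume that the auto-covariance $C(\ell)=\mathbb{E}(u(X_1)u(X_\ell))-(\mathbb{E}(u(X_1)))^2$, $\ell\ge1$, is absolutely summable, that $$\sigma^2=C(1)+2\sum_{\ell=2}^\infty C(\ell)\ne0,$$ and that the process $(u(X_k))$ satisfies the central limit theorem, i.e. for every $t\in\mathbb{R}$ $$\lim_{n\to\infty}\mathbb{P}\left(\frac{\sum_{j=1}^n u(X_j)}{\sigma\sqrt n}\le t\right)=\frac1{\sqrt{2\pi}}\int_{-\infty}^t e^{-\xi^2/2}\,d\xi .$$ Then $\mathbb{P}$-almost surely $$\lim_{n\to\infty}\kappa\big(\mathcal{A}_n,\mathcal{N}(0,\sigma^2)\big)=0,$$ where $\mathcal{N}(0,\sigma^2)$ is the Gaussian measure with mean zero and variance $\sigma^2$, $\kappa$ is the Kantorovich distance, and $$\mathcal{A}_n=\frac1{D_n}\sum_{k=1}^n\frac1k\,\delta_{S_k/\sqrt k},\qquad D_n=\sum_{k=1}^n\frac1k,\qquad S_k=u(X_1)+\cdots+u(X_k).$$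
   Context: Kantorovich distance between probability measures on $\mathbb{R}$: $\kappa(\mu_1,\mu_2)=\sup_{g\in\mathscr{L}}\int g\,d(\mu_1-\mu_2)$, where $\mathscr{L}$ is the set of real-valued Lipschitz functions on $\mathbb{R}$ with Lipschitz constant at most one. $A>0$ is a constant and $\delta_x$ is the Dirac measure at $x$. For $\eta\in(0,1]$, a function $K:(\mathbb{R}^d)^n\to\mathbb{R}$ is separately $\eta$-Hölder if for every $1\le j\le n$ $$L_j(K)=\sup_{x_1,\ldots,x_n}\ \sup_{\tilde x_j\ne x_j}\frac{|K(x_1,\ldots,x_j,\ldots,x_n)-K(x_1,\ldots,\tilde x_j,\ldots,x_n)|}{\Vert x_j-\tilde x_j\Vert^\eta}<\infty .$$ The process satisfies the Devroye inequality if for every $\eta\in(0,1]$ there is a constant $D=D(\eta)>0$ such that for every integer $n\ge1$ and every real-valued separately $\eta$-Hölder function $K$ on $(\mathbb{R}^d)^n$, $\mathrm{var}(K(X_1,\ldots,X_n))\le D\sum_{j=1}^n L_j(K)^2$. *)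

theory Defs
  imports "HOL-Probability.Probability"
begin

text \<open>
  Processes are families \<open>X :: nat \<Rightarrow> 'a \<Rightarrow> _\<close> of which only the indices \<open>k \<ge> 1\<close> matter;
  \<open>X 0\<close> is never referred to.
\<close>

definition path_space :: "(nat \<Rightarrow> 'b::topological_space) measure" where
  "path_space = Pi\<^sub>M {1..} (\<lambda>_. borel)"

definition path_law :: "'a measure \<Rightarrow> (nat \<Rightarrow> 'a \<Rightarrow> 'b::topological_space) \<Rightarrow> (nat \<Rightarrow> 'b) measure" where
  "path_law M X = distr M path_space (\<lambda>\<omega>. \<lambda>k\<in>{1..}. X k \<omega>)"

definition path_shift :: "(nat \<Rightarrow> 'b) \<Rightarrow> nat \<Rightarrow> 'b" where
  "path_shift x = (\<lambda>k\<in>{1..}. x (Suc k))"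

definition stationary :: "'a measure \<Rightarrow> (nat \<Rightarrow> 'a \<Rightarrow> 'b::topological_space) \<Rightarrow> bool" where
  "stationary M X \<longleftrightarrow> distr (path_law M X) path_space path_shift = path_law M X"

definition ergodic :: "'a measure \<Rightarrow> (nat \<Rightarrow> 'a \<Rightarrow> 'b::topological_space) \<Rightarrow> bool" where
  "ergodic M X \<longleftrightarrow>
     (\<forall>B\<in>sets path_space. path_shift -` B \<inter> space path_space = B \<longrightarrow>
        measure (path_law M X) B \<in> {0, 1})"

text \<open>
  A function of \<open>n\<close> vector variables is a function \<open>K\<close> on the extensional product
  \<open>{1..n} \<rightarrow>\<^sub>E UNIV\<close>; its values outside that set are irrelevant.  The partial Hoelder
  constants live in \<open>ereal\<close>, so that finiteness is a genuine condition.
\<close>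

definition partial_holder_const ::
    "nat \<Rightarrow> real \<Rightarrow> ((nat \<Rightarrow> 'b::real_normed_vector) \<Rightarrow> real) \<Rightarrow> nat \<Rightarrow> ereal" where
  "partial_holder_const n \<eta> K j =
     (SUP x\<in>{1..n} \<rightarrow>\<^sub>E UNIV. SUP y\<in>- {x j}.
        ereal (\<bar>K x - K (x(j := y))\<bar> / norm (x j - y) powr \<eta>))"

definition separately_holder ::
    "nat \<Rightarrow> real \<Rightarrow> ((nat \<Rightarrow> 'b::real_normed_vector) \<Rightarrow> real) \<Rightarrow> bool" where
  "separately_holder n \<eta> K \<longleftrightarrow> (\<forall>j\<in>{1..n}. partial_holder_const n \<eta> K j < \<infinity>)"

text \<open>
  The variance is a Bochner integral.  A separately Hoelder function is continuous, so for an
  almost surely bounded process \<open>K (X\<^sub>1, \<dots>, X\<^sub>n)\<close> is square integrable and no default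
  values of the integral are involved.
\<close>

definition devroye_inequality ::
    "'a measure \<Rightarrow> (nat \<Rightarrow> 'a \<Rightarrow> 'b::real_normed_vector) \<Rightarrow> bool" where
  "devroye_inequality M X \<longleftrightarrow>
     (\<forall>\<eta>. 0 < \<eta> \<and> \<eta> \<le> 1 \<longrightarrow>
       (\<exists>D>0. \<forall>n\<ge>1. \<forall>K. separately_holder n \<eta> K \<longrightarrow>
          prob_space.variance M (\<lambda>\<omega>. K (\<lambda>i\<in>{1..n}. X i \<omega>))
            \<le> D * (\<Sum>j=1..n. (real_of_ereal (partial_holder_const n \<eta> K j))\<^sup>2)))"

definition holder_continuous :: "('b::metric_space \<Rightarrow> real) \<Rightarrow> bool" where
  "holder_continuous u \<longleftrightarrow>
     (\<exists>\<beta> C. 0 < \<beta> \<and> \<beta> \<le> 1 \<and> (\<forall>x y. \<bar>u x - u y\<bar> \<le> C * dist x y powr \<beta>))"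

definition auto_covariance :: "'a measure \<Rightarrow> (nat \<Rightarrow> 'a \<Rightarrow> real) \<Rightarrow> nat \<Rightarrow> real" where
  "auto_covariance M Y l =
     (\<integral>\<omega>. Y 1 \<omega> * Y l \<omega> \<partial>M) - (\<integral>\<omega>. Y 1 \<omega> \<partial>M)\<^sup>2"

text \<open>
  Intended for probability measures with finite first moment, for which every Lipschitz
  function is integrable; \<open>\<integral> g d(\<mu>\<^sub>1 - \<mu>\<^sub>2)\<close> is the difference of the two integrals.
\<close>

definition kantorovich :: "real measure \<Rightarrow> real measure \<Rightarrow> ereal" where
  "kantorovich \<mu>1 \<mu>2 =
     (SUP g\<in>{g :: real \<Rightarrow> real. 1-lipschitz_on UNIV g}.
        ereal ((\<integral>x. g x \<partial>\<mu>1) - (\<integral>x. g x \<partial>\<mu>2)))"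

definition partial_sum :: "(nat \<Rightarrow> 'a \<Rightarrow> real) \<Rightarrow> nat \<Rightarrow> 'a \<Rightarrow> real" where
  "partial_sum Y k \<omega> = (\<Sum>j=1..k. Y j \<omega>)"

text \<open>
  There is no addition of measures in the library: the weighted sum of Dirac measures is the
  image of the weights \<open>1 / (k D\<^sub>n)\<close>, \<open>D\<^sub>n = harm n\<close>, on \<open>{1..n}\<close> under \<open>k \<mapsto> S\<^sub>k / \<surd>k\<close>;
  see the lemma \<open>emeasure_log_empirical_measure\<close>.
\<close>

definition log_empirical_measure :: "(nat \<Rightarrow> 'a \<Rightarrow> real) \<Rightarrow> nat \<Rightarrow> 'a \<Rightarrow> real measure" where
  "log_empirical_measure Y n \<omega> =
     distr (point_measure {1..n} (\<lambda>k. ennreal (1 / harm n * (1 / real k)))) borel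
       (\<lambda>k. partial_sum Y k \<omega> / sqrt (real k))"

lemma emeasure_log_empirical_measure:
  assumes "B \<in> sets borel"
  shows "emeasure (log_empirical_measure Y n \<omega>) B =
    (\<Sum>k=1..n. ennreal (1 / harm n * (1 / real k)) *
       emeasure (return borel (partial_sum Y k \<omega> / sqrt (real k))) B)"
proof -
  let ?w = "\<lambda>k. ennreal (1 / harm n * (1 / real k))"
  let ?f = "\<lambda>k. partial_sum Y k \<omega> / sqrt (real k)"
  have "emeasure (log_empirical_measure Y n \<omega>) B
      = emeasure (point_measure {1..n} ?w) (?f -` B \<inter> {1..n})"
    unfolding log_empirical_measure_def
    using assms by (subst emeasure_distr) (auto simp: space_point_measure)
  also have "\<dots> = (\<Sum>k\<in>?f -` B \<inter> {1..n}. ?w k)"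
    by (rule emeasure_point_measure_finite) auto
  also have "\<dots> = (\<Sum>k=1..n. ?w k * indicator B (?f k))"
    by (rule sum.mono_neutral_cong_left) (auto simp: indicator_def)
  finally show ?thesis
    using assms by simp
qed

end

theory Submission
  imports Defs
begin

text \<open>
  On the real line, convergence in the Kantorovich distance follows from convergence of the integrals
  of the countably many functions \<open>\<bar>x - a\<bar>\<close>, \<open>a\<close> rational: their combinations include the piecewise
  linear interpolations of a Lipschitz function as well as the tails \<open>max 0 (\<bar>x\<bar> - R)\<close>.  For a fixed
  1-Lipschitz \<open>f \<ge> 0\<close>, the Devroye inequality bounds the variance of \<open>\<integral> f d\<A>\<^sub>n\<close> by a multiple of \<open>1 / D\<^sub>n\<close>,
  so these integrals concentrate around their means along a subsequence with \<open>D\<^sub>n\<close> of order \<open>i\<^sup>2\<close>;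
  as nonnegativity makes \<open>D\<^sub>n \<integral> f d\<A>\<^sub>n\<close> monotone in \<open>n\<close>, the gaps of the subsequence can be filled.  The means
  converge by the central limit theorem, with uniform integrability supplied by the Devroye bound
  on the variance of \<open>S\<^sub>k\<close>, followed by logarithmic Cesaro averaging.
\<close>

section \<open>Kantorovich distance and potentials\<close>

text \<open>
  The summands below are ramps rising from 0 to \<open>\<delta>\<close> between neighbouring grid points, so the sum is the
  piecewise linear interpolation of \<open>g\<close>; the ramps are written through \<open>\<bar>x - a\<bar>\<close> because only the
  integrals of these functions are controlled later.
\<close>

lemma ramp_sum_eq:
  fixes g :: "real \<Rightarrow> real"
  assumes "\<delta> > 0" "a + real m * \<delta> \<le> x"
  shows "g a + (\<Sum>i<m. (g (a + real (Suc i) * \<delta>) - g (a + real i * \<delta>)) / \<delta> *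
      ((\<bar>x - (a + real i * \<delta>)\<bar> - \<bar>x - (a + real (Suc i) * \<delta>)\<bar> + \<delta>) / 2)) = g (a + real m * \<delta>)"
  using assms(2)
proof (induction m)
  case (Suc m)
  have *: "a + real m * \<delta> + \<delta> \<le> x" using Suc.prems by (simp add: algebra_simps)
  have r: "(\<bar>x - (a + real m * \<delta>)\<bar> - \<bar>x - (a + real (Suc m) * \<delta>)\<bar> + \<delta>) / 2 = \<delta>"
    using * \<open>\<delta> > 0\<close> by (simp add: algebra_simps)
  have IH: "g a + (\<Sum>i<m. (g (a + real (Suc i) * \<delta>) - g (a + real i * \<delta>)) / \<delta> *
      ((\<bar>x - (a + real i * \<delta>)\<bar> - \<bar>x - (a + real (Suc i) * \<delta>)\<bar> + \<delta>) / 2)) = g (a + real m * \<delta>)"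
    using Suc.IH * \<open>\<delta> > 0\<close> by linarith
  show ?case
    unfolding sum.lessThan_Suc r using IH \<open>\<delta> > 0\<close> by simp
qed simp

text \<open>Outside the grid the interpolation is constant, hence the comparison with
  \<open>g\<close> at the point of \<open>[a, a + m * \<delta>]\<close> nearest to \<open>x\<close>.
  Induction on \<open>m\<close>: if \<open>x\<close> is not beyond \<open>a + m * \<delta>\<close>,
  the new ramp vanishes and the nearest point stays the same. Otherwise the earlier ramps add up
  exactly to the value of \<open>g\<close> at that grid point by \<open>ramp_sum_eq\<close>, and the
  new ramp and the move of the nearest point cost at most \<open>\<delta>\<close> each.\<close>

lemma ramp_sum_approx:
  fixes g :: "real \<Rightarrow> real"
  assumes g: "1-lipschitz_on UNIV g" and "\<delta> > 0"
  shows "\<bar>g a + (\<Sum>i<m. (g (a + real (Suc i) * \<delta>) - g (a + real i * \<delta>)) / \<delta> *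
      ((\<bar>x - (a + real i * \<delta>)\<bar> - \<bar>x - (a + real (Suc i) * \<delta>)\<bar> + \<delta>) / 2))
      - g (max a (min x (a + real m * \<delta>)))\<bar> \<le> 2 * \<delta>"
proof (induction m)
  case 0
  then show ?case using \<open>\<delta> > 0\<close> by (simp add: max_def min_def)
next
  case (Suc m)
  let ?b = "a + real m * \<delta>"
  let ?\<psi> = "(\<bar>x - ?b\<bar> - \<bar>x - (a + real (Suc m) * \<delta>)\<bar> + \<delta>) / 2"
  have b: "a \<le> ?b" using \<open>\<delta> > 0\<close> by simp
  have b': "a + real (Suc m) * \<delta> = ?b + \<delta>" by (simp add: algebra_simps)
  have lip: "\<bar>g s - g t\<bar> \<le> \<bar>s - t\<bar>" for s t
    using lipschitz_onD[OF g, of s t] by (simp add: dist_real_def)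
  show ?case
  proof (cases "x \<le> ?b")
    case True
    then have "?\<psi> = 0" using \<open>\<delta> > 0\<close> unfolding b' by simp
    moreover have "min x (a + real (Suc m) * \<delta>) = min x ?b"
      using True \<open>\<delta> > 0\<close> unfolding b' by simp
    ultimately show ?thesis using Suc.IH unfolding sum.lessThan_Suc by simp
  next
    case False
    have c: "\<bar>(g (a + real (Suc m) * \<delta>) - g ?b) / \<delta>\<bar> \<le> 1"
      using lip[of "a + real (Suc m) * \<delta>" ?b] \<open>\<delta> > 0\<close> by (simp add: b' field_simps)
    have "0 \<le> (\<bar>x - b\<bar> - \<bar>x - (b + \<delta>)\<bar> + \<delta>) / 2" "(\<bar>x - b\<bar> - \<bar>x - (b + \<delta>)\<bar> + \<delta>) / 2 \<le> \<delta>" for b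
      using \<open>\<delta> > 0\<close> by (auto simp: abs_if)
    from this[of ?b] have p: "\<bar>?\<psi>\<bar> \<le> \<delta>" unfolding b' by (simp only: abs_of_nonneg)
    have d: "\<bar>(g (a + real (Suc m) * \<delta>) - g ?b) / \<delta> * ?\<psi>\<bar> \<le> \<delta>"
      unfolding abs_mult using mult_mono[OF c p] by (simp only: mult_1_left zero_le_one abs_ge_zero)
    let ?c = "max a (min x (a + real (Suc m) * \<delta>))"
    have "\<bar>max a (min x (b + \<delta>)) - b\<bar> \<le> \<delta>" if "a \<le> b" "\<not> x \<le> b" for b
      using that \<open>\<delta> > 0\<close> by (simp add: max_def min_def)
    from this[OF b False] have "\<bar>?c - ?b\<bar> \<le> \<delta>" unfolding b' .
    then have e: "\<bar>g ?c - g ?b\<bar> \<le> \<delta>" using lip[of ?c ?b] by linarith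
    have s: "g a + (\<Sum>i<m. (g (a + real (Suc i) * \<delta>) - g (a + real i * \<delta>)) / \<delta> *
      ((\<bar>x - (a + real i * \<delta>)\<bar> - \<bar>x - (a + real (Suc i) * \<delta>)\<bar> + \<delta>) / 2)) = g ?b"
      by (rule ramp_sum_eq) (use False \<open>\<delta> > 0\<close> in auto)
    have "\<bar>p + q - r\<bar> \<le> 2 * \<delta>" if "\<bar>q\<bar> \<le> \<delta>" "\<bar>r - p\<bar> \<le> \<delta>" for p q r :: real
      using that by linarith
    from this[OF d e] show ?thesis
      unfolding sum.lessThan_Suc add.assoc[symmetric] s .
  qed
qed

lemma integrable_lipschitz:
  fixes g :: "real \<Rightarrow> real"
  assumes "finite_measure N" and sets[measurable_cong]: "sets N = sets borel"
    and i: "integrable N (\<lambda>x. \<bar>x\<bar>)" and g: "L-lipschitz_on UNIV g"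
  shows "integrable N g"
proof -
  interpret finite_measure N by fact
  have "continuous_on UNIV g" using g by (rule lipschitz_on_continuous_on)
  then have [measurable]: "g \<in> borel_measurable borel" by (rule borel_measurable_continuous_onI)
  show ?thesis
  proof (rule Bochner_Integration.integrable_bound[where f = "\<lambda>x. \<bar>g 0\<bar> + L * \<bar>x\<bar>"])
    show "AE x in N. norm (g x) \<le> norm (\<bar>g 0\<bar> + L * \<bar>x\<bar>)"
    proof (rule AE_I2)
      fix x
      show "norm (g x) \<le> norm (\<bar>g 0\<bar> + L * \<bar>x\<bar>)"
        using lipschitz_onD[OF g, of x 0] by (simp add: dist_real_def)
    qed
  qed (use i in auto)
qed

text \<open>The bound must not depend on the test function \<open>g\<close>. Interpolating
  \<open>g\<close> on \<open>[-R, R]\<close> leaves the error \<open>2 * \<delta>\<close> plus the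
  tail \<open>T\<close>, which is itself a combination of the potentials at \<open>R\<close> and
  \<open>-R\<close>. The slopes of the interpolation are at most 1 in modulus, so its two integrals
  differ by no more than the potentials do at the grid points, and the constant
  \<open>g (- R)\<close> cancels. The tail under \<open>\<mu>\<close> is traded for the one under
  \<open>\<nu>\<close>, so only the latter has to be small.\<close>

lemma kantorovich_le_potentials:
  fixes \<mu> \<nu> :: "real measure"
  assumes \<mu>: "real_distribution \<mu>" "integrable \<mu> (\<lambda>x. \<bar>x\<bar>)"
    and \<nu>: "real_distribution \<nu>" "integrable \<nu> (\<lambda>x. \<bar>x\<bar>)"
    and "\<delta> > 0" and m: "real m * \<delta> = 2 * R"
  defines "\<Delta> \<equiv> \<lambda>a. \<bar>(\<integral>x. \<bar>x - a\<bar> \<partial>\<mu>) - (\<integral>x. \<bar>x - a\<bar> \<partial>\<nu>)\<bar>"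
  shows "kantorovich \<mu> \<nu> \<le> ereal (4 * \<delta> + 2 * (\<integral>x. max 0 (\<bar>x\<bar> - R) \<partial>\<nu>) + (\<Delta> R + \<Delta> (-R)) / 2
     + (\<Sum>i<m. (\<Delta> (- R + real i * \<delta>) + \<Delta> (- R + real (Suc i) * \<delta>)) / 2))"
  unfolding kantorovich_def
proof (rule SUP_least)
  fix g :: "real \<Rightarrow> real"
  assume "g \<in> {g. 1-lipschitz_on UNIV g}"
  then have g: "1-lipschitz_on UNIV g" by simp
  interpret \<mu>: real_distribution \<mu> by fact
  interpret \<nu>: real_distribution \<nu> by fact
  have R: "R \<ge> 0" using m \<open>\<delta> > 0\<close> by (metis mult_nonneg_nonneg of_nat_0_le_iff order_less_imp_le zero_le_mult_iff zero_less_numeral not_le)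
  have lip: "\<bar>g s - g t\<bar> \<le> \<bar>s - t\<bar>" for s t
    using lipschitz_onD[OF g, of s t] by (simp add: dist_real_def)
  define T :: "real \<Rightarrow> real" where "T x = (\<bar>x - R\<bar> + \<bar>x - (- R)\<bar>) / 2 - R" for x
  have T: "T x = max 0 (\<bar>x\<bar> - R)" for x using R by (auto simp: T_def max_def abs_if)
  define \<psi> where "\<psi> i x = (\<bar>x - (- R + real i * \<delta>)\<bar> - \<bar>x - (- R + real (Suc i) * \<delta>)\<bar> + \<delta>) / 2" for i x
  define c where "c i = (g (- R + real (Suc i) * \<delta>) - g (- R + real i * \<delta>)) / \<delta>" for i
  define G where "G x = g (- R) + (\<Sum>i<m. c i * \<psi> i x)" for x
  have c: "\<bar>c i\<bar> \<le> 1" for i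
    using lip[of "- R + real (Suc i) * \<delta>" "- R + real i * \<delta>"] \<open>\<delta> > 0\<close>
    by (simp add: c_def field_simps)
  \<comment> \<open>Clamping \<open>x\<close> to \<open>[-R, R]\<close> moves it by
    \<open>T x\<close>, and \<open>g\<close> is 1-Lipschitz.\<close>
  have app: "\<bar>g x - G x\<bar> \<le> 2 * \<delta> + T x" for x
  proof -
    have "\<bar>G x - g (max (- R) (min x (- R + real m * \<delta>)))\<bar> \<le> 2 * \<delta>"
      unfolding G_def c_def \<psi>_def by (rule ramp_sum_approx[OF g \<open>\<delta> > 0\<close>])
    moreover have "\<bar>x - max (- R) (min x (- R + real m * \<delta>))\<bar> \<le> T x"
      unfolding T m using R by (auto simp: max_def min_def)
    ultimately show ?thesis using lip[of x "max (- R) (min x (- R + real m * \<delta>))"] by linarith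
  qed
  have ia: "integrable N (\<lambda>x. \<bar>x - a\<bar>)" if "finite_measure N" "sets N = sets borel" "integrable N (\<lambda>x. \<bar>x\<bar>)"
    for N :: "real measure" and a
    by (rule integrable_lipschitz[OF that, where L = 1]) (auto simp: lipschitz_on_def dist_real_def)
  \<comment> \<open>A generic measure \<open>N\<close> with potential \<open>P\<close>, to be
    instantiated with both \<open>\<mu>\<close> and \<open>\<nu>\<close>.\<close>
  have key: "\<bar>(\<integral>x. g x \<partial>N) - (g (- R) + (\<Sum>i<m. c i * ((P (- R + real i * \<delta>) - P (- R + real (Suc i) * \<delta>) + \<delta>) / 2)))\<bar>
       \<le> 2 * \<delta> + ((P R + P (- R)) / 2 - R) \<and> ((P R + P (- R)) / 2 - R) = (\<integral>x. T x \<partial>N)"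
    if N: "real_distribution N" "integrable N (\<lambda>x. \<bar>x\<bar>)" and P: "P = (\<lambda>a. \<integral>x. \<bar>x - a\<bar> \<partial>N)"
    for N :: "real measure" and P
  proof -
    interpret N: real_distribution N by fact
    have i: "integrable N (\<lambda>x. \<bar>x - a\<bar>)" for a
      by (rule ia) (use N in \<open>auto intro: N.finite_measure_axioms\<close>)
    have ig: "integrable N g" by (rule integrable_lipschitz[OF _ _ N(2) g]) (auto intro: N.finite_measure_axioms)
    have iG: "integrable N G" unfolding G_def \<psi>_def using i by (intro Bochner_Integration.integrable_add integrable_sum integrable_mult_right Bochner_Integration.integrable_diff integrable_divide) auto
    have iT: "integrable N T" unfolding T_def by (intro Bochner_Integration.integrable_add Bochner_Integration.integrable_diff integrable_divide i N.integrable_const)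
    have eT: "(\<integral>x. T x \<partial>N) = (P R + P (- R)) / 2 - R"
      unfolding T_def P using i[of R] i[of "-R"] N.prob_space by simp
    have ip: "integrable N (\<psi> i)" for i
      unfolding \<psi>_def using i by (intro Bochner_Integration.integrable_add Bochner_Integration.integrable_diff integrable_divide) auto
    have ep: "(\<integral>x. \<psi> i x \<partial>N) = (P (- R + real i * \<delta>) - P (- R + real (Suc i) * \<delta>) + \<delta>) / 2" for i
      unfolding \<psi>_def P using i[of "- R + real i * \<delta>"] i[of "- R + real (Suc i) * \<delta>"] N.prob_space
      by (simp del: of_nat_Suc)
    have eG: "(\<integral>x. G x \<partial>N) = g (- R) + (\<Sum>i<m. c i * ((P (- R + real i * \<delta>) - P (- R + real (Suc i) * \<delta>) + \<delta>) / 2))"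
      unfolding G_def using ip N.prob_space by (simp add: ep integrable_sum del: of_nat_Suc)
    have "\<bar>(\<integral>x. g x \<partial>N) - (\<integral>x. G x \<partial>N)\<bar> = \<bar>\<integral>x. g x - G x \<partial>N\<bar>"
      using ig iG by simp
    also have "\<dots> \<le> (\<integral>x. \<bar>g x - G x\<bar> \<partial>N)" by (rule integral_abs_bound)
    also have "\<dots> \<le> (\<integral>x. 2 * \<delta> + T x \<partial>N)"
      by (rule integral_mono) (use ig iG iT app in auto)
    also have "\<dots> = 2 * \<delta> + (\<integral>x. T x \<partial>N)" using iT N.prob_space by simp
    finally show ?thesis unfolding eG eT by simp
  qed
  let ?P = "\<lambda>a. \<integral>x. \<bar>x - a\<bar> \<partial>\<mu>" and ?Q = "\<lambda>a. \<integral>x. \<bar>x - a\<bar> \<partial>\<nu>"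
  note k1 = key[OF \<mu> refl] and k2 = key[OF \<nu> refl]
  have sum_le: "(\<Sum>i<m. c i * ((?P (- R + real i * \<delta>) - ?P (- R + real (Suc i) * \<delta>) + \<delta>) / 2))
      - (\<Sum>i<m. c i * ((?Q (- R + real i * \<delta>) - ?Q (- R + real (Suc i) * \<delta>) + \<delta>) / 2))
     \<le> (\<Sum>i<m. (\<Delta> (- R + real i * \<delta>) + \<Delta> (- R + real (Suc i) * \<delta>)) / 2)"
    unfolding sum_subtractf[symmetric]
  proof (rule sum_mono)
    fix i
    let ?a = "- R + real i * \<delta>" and ?b = "- R + real (Suc i) * \<delta>"
    have "c i * ((?P ?a - ?P ?b + \<delta>) / 2) - c i * ((?Q ?a - ?Q ?b + \<delta>) / 2)
        = c i * (((?P ?a - ?Q ?a) - (?P ?b - ?Q ?b)) / 2)" by (simp add: field_simps)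
    also have "\<dots> \<le> \<bar>c i\<bar> * \<bar>((?P ?a - ?Q ?a) - (?P ?b - ?Q ?b)) / 2\<bar>"
      unfolding abs_mult[symmetric] by simp
    also have "\<dots> \<le> 1 * \<bar>((?P ?a - ?Q ?a) - (?P ?b - ?Q ?b)) / 2\<bar>"
      using c by (intro mult_right_mono) auto
    also have "\<dots> \<le> (\<Delta> ?a + \<Delta> ?b) / 2"
      unfolding \<Delta>_def abs_divide using abs_triangle_ineq4[of "?P ?a - ?Q ?a" "?P ?b - ?Q ?b"]
      by (simp del: of_nat_Suc)
    finally show "c i * ((?P ?a - ?P ?b + \<delta>) / 2) - c i * ((?Q ?a - ?Q ?b + \<delta>) / 2) \<le> (\<Delta> ?a + \<Delta> ?b) / 2" .
  qed
  have pot: "?P a \<le> ?Q a + \<Delta> a" for a by (simp add: \<Delta>_def)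
  have "(?P R + ?P (- R)) / 2 - R \<le> (?Q R + ?Q (- R)) / 2 - R + (\<Delta> R + \<Delta> (-R)) / 2"
    using pot[of R] pot[of "- R"] by argo
  moreover have "(?Q R + ?Q (- R)) / 2 - R = (\<integral>x. max 0 (\<bar>x\<bar> - R) \<partial>\<nu>)"
    using k2 by (simp add: T)
  ultimately have "(\<integral>x. g x \<partial>\<mu>) - (\<integral>x. g x \<partial>\<nu>) \<le> 4 * \<delta> + 2 * (\<integral>x. max 0 (\<bar>x\<bar> - R) \<partial>\<nu>) + (\<Delta> R + \<Delta> (-R)) / 2
     + (\<Sum>i<m. (\<Delta> (- R + real i * \<delta>) + \<Delta> (- R + real (Suc i) * \<delta>)) / 2)"
    using k1 k2 sum_le unfolding abs_le_iff by linarith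
  then show "ereal ((\<integral>x. g x \<partial>\<mu>) - (\<integral>x. g x \<partial>\<nu>)) \<le> ereal (4 * \<delta> + 2 * (\<integral>x. max 0 (\<bar>x\<bar> - R) \<partial>\<nu>)
     + (\<Delta> R + \<Delta> (-R)) / 2 + (\<Sum>i<m. (\<Delta> (- R + real i * \<delta>) + \<Delta> (- R + real (Suc i) * \<delta>)) / 2))"
    by simp
qed

lemma kantorovich_nonneg: "0 \<le> kantorovich \<mu> \<nu>"
  unfolding kantorovich_def
  by (rule SUP_upper2[where i = "\<lambda>_. 0"]) (auto simp: lipschitz_on_def)

lemma tail_integral_tendsto_zero:
  fixes \<nu> :: "real measure"
  assumes [measurable_cong]: "sets \<nu> = sets borel" and "integrable \<nu> (\<lambda>x. \<bar>x\<bar>)"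
  shows "(\<lambda>r. \<integral>x. max 0 (\<bar>x\<bar> - real r) \<partial>\<nu>) \<longlonglongrightarrow> 0"
proof -
  have "(\<lambda>r. \<integral>x. max 0 (\<bar>x\<bar> - real r) \<partial>\<nu>) \<longlonglongrightarrow> (\<integral>x. 0 \<partial>\<nu>)"
  proof (rule integral_dominated_convergence[where w = "\<lambda>x. \<bar>x\<bar>"])
    show "AE x in \<nu>. (\<lambda>r. max 0 (\<bar>x\<bar> - real r)) \<longlonglongrightarrow> 0"
    proof (rule AE_I2)
      fix x :: real
      have "\<forall>\<^sub>F r in sequentially. \<bar>x\<bar> \<le> real r"
        using filterlim_real_sequentially by (auto simp: filterlim_at_top)
      then show "(\<lambda>r. max 0 (\<bar>x\<bar> - real r)) \<longlonglongrightarrow> 0"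
        by (intro tendsto_eventually) (auto elim!: eventually_mono)
    qed
  qed (use assms in auto)
  then show ?thesis by simp
qed

text \<open>Once radius and mesh are fixed, only finitely many potentials occur in
  \<open>kantorovich_le_potentials\<close>, so convergence at each rational point suffices.\<close>

lemma kantorovich_tendsto_zero_if_potentials:
  fixes \<mu> :: "nat \<Rightarrow> real measure"
  assumes \<mu>: "\<And>n. real_distribution (\<mu> n)" "\<And>n. integrable (\<mu> n) (\<lambda>x. \<bar>x\<bar>)"
    and \<nu>: "real_distribution \<nu>" "integrable \<nu> (\<lambda>x. \<bar>x\<bar>)"
    and lim: "\<And>a. a \<in> \<rat> \<Longrightarrow> (\<lambda>n. \<integral>x. \<bar>x - a\<bar> \<partial>\<mu> n) \<longlonglongrightarrow> (\<integral>x. \<bar>x - a\<bar> \<partial>\<nu>)"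
  shows "(\<lambda>n. kantorovich (\<mu> n) \<nu>) \<longlonglongrightarrow> 0"
proof -
  interpret \<nu>: real_distribution \<nu> by fact
  have upper: "\<forall>\<^sub>F n in sequentially. kantorovich (\<mu> n) \<nu> < ereal \<epsilon>" if \<epsilon>: "\<epsilon> > 0" for \<epsilon> :: real
  proof -
    have "(\<lambda>r. \<integral>x. max 0 (\<bar>x\<bar> - real r) \<partial>\<nu>) \<longlonglongrightarrow> 0"
      by (rule tail_integral_tendsto_zero) (use \<nu> in auto)
    then have "\<forall>\<^sub>F r in sequentially. (\<integral>x. max 0 (\<bar>x\<bar> - real r) \<partial>\<nu>) < \<epsilon> / 4"
      using \<epsilon> by (intro order_tendstoD(2)) auto
    then obtain r where r: "(\<integral>x. max 0 (\<bar>x\<bar> - real r) \<partial>\<nu>) < \<epsilon> / 4"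
      by (auto simp: eventually_sequentially)
    \<comment> \<open>An integer radius \<open>r\<close> and the mesh \<open>1 / (p + 1)\<close>
      make all grid points rational, and \<open>2 * r * (p + 1)\<close> cells fill
      \<open>[-r, r]\<close> exactly. The interpolation error \<open>4 * \<delta>\<close> and twice
      the tail are each below \<open>\<epsilon> / 2\<close>.\<close>
    obtain p where p: "inverse (real (Suc p)) < \<epsilon> / 8"
      using reals_Archimedean[of "\<epsilon> / 8"] \<epsilon> by auto
    define \<delta> where "\<delta> = inverse (real (Suc p))"
    define m where "m = 2 * r * Suc p"
    have "\<delta> > 0" by (simp add: \<delta>_def)
    have m: "real m * \<delta> = 2 * real r" unfolding m_def \<delta>_def of_nat_mult by (simp add: mult.assoc del: of_nat_Suc)
    define \<Delta> where "\<Delta> n a = \<bar>(\<integral>x. \<bar>x - a\<bar> \<partial>\<mu> n) - (\<integral>x. \<bar>x - a\<bar> \<partial>\<nu>)\<bar>" for n a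
    have \<Delta>: "(\<lambda>n. \<Delta> n a) \<longlonglongrightarrow> 0" if "a \<in> \<rat>" for a
      unfolding \<Delta>_def using tendsto_diff[OF lim[OF that] tendsto_const[of "\<integral>x. \<bar>x - a\<bar> \<partial>\<nu>"]]
      by (intro tendsto_rabs_zero) simp
    have "\<delta> \<in> \<rat>" by (simp add: \<delta>_def del: of_nat_Suc)
    have "(\<lambda>n. 4 * \<delta> + 2 * (\<integral>x. max 0 (\<bar>x\<bar> - real r) \<partial>\<nu>) + (\<Delta> n r + \<Delta> n (- real r)) / 2
       + (\<Sum>i<m. (\<Delta> n (- real r + real i * \<delta>) + \<Delta> n (- real r + real (Suc i) * \<delta>)) / 2))
       \<longlonglongrightarrow> 4 * \<delta> + 2 * (\<integral>x. max 0 (\<bar>x\<bar> - real r) \<partial>\<nu>) + (0 + 0) / 2 + (\<Sum>i<m. (0 + 0) / 2)"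
      by (intro tendsto_intros \<Delta>) (use \<open>\<delta> \<in> \<rat>\<close> in auto)
    moreover have "4 * \<delta> + 2 * (\<integral>x. max 0 (\<bar>x\<bar> - real r) \<partial>\<nu>) + (0 + 0) / 2 + (\<Sum>i<m. (0 + 0) / 2) < \<epsilon>"
      using p r by (simp add: \<delta>_def)
    ultimately have "\<forall>\<^sub>F n in sequentially. 4 * \<delta> + 2 * (\<integral>x. max 0 (\<bar>x\<bar> - real r) \<partial>\<nu>) + (\<Delta> n r + \<Delta> n (- real r)) / 2
       + (\<Sum>i<m. (\<Delta> n (- real r + real i * \<delta>) + \<Delta> n (- real r + real (Suc i) * \<delta>)) / 2) < \<epsilon>"
      by (rule order_tendstoD(2))
    then show ?thesis
    proof (rule eventually_mono)
      fix n
      assume "4 * \<delta> + 2 * (\<integral>x. max 0 (\<bar>x\<bar> - real r) \<partial>\<nu>) + (\<Delta> n r + \<Delta> n (- real r)) / 2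
       + (\<Sum>i<m. (\<Delta> n (- real r + real i * \<delta>) + \<Delta> n (- real r + real (Suc i) * \<delta>)) / 2) < \<epsilon>"
      then show "kantorovich (\<mu> n) \<nu> < ereal \<epsilon>"
        using kantorovich_le_potentials[OF \<mu>(1)[of n] \<mu>(2)[of n] \<nu> \<open>\<delta> > 0\<close> m]
        unfolding \<Delta>_def by (meson ereal_less_eq(3) le_less_trans less_ereal.simps(1))
    qed
  qed
  show ?thesis
  proof (rule order_tendstoI)
    fix a :: ereal
    assume "a < 0"
    then show "\<forall>\<^sub>F n in sequentially. a < kantorovich (\<mu> n) \<nu>"
      using kantorovich_nonneg less_le_trans by (intro always_eventually allI) blast
  next
    fix a :: ereal
    assume "0 < a"
    then obtain \<epsilon> where "0 < ereal \<epsilon>" "ereal \<epsilon> < a" using ereal_dense2 by blast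
    then show "\<forall>\<^sub>F n in sequentially. kantorovich (\<mu> n) \<nu> < a"
      using upper[of \<epsilon>] by (auto elim!: eventually_mono)
  qed
qed

section \<open>Logarithmic averages\<close>

text \<open>The weights \<open>1 / (k * harm n)\<close> add up to 1, and as the harmonic numbers
  diverge, any initial segment loses its weight: the deviations before \<open>N\<close> contribute
  at most \<open>c / harm n\<close>, the later ones at most \<open>\<epsilon> / 2\<close>.\<close>

lemma log_cesaro:
  fixes a :: "nat \<Rightarrow> real"
  assumes "a \<longlonglongrightarrow> L"
  shows "(\<lambda>n. (\<Sum>k=1..n. a k / real k) / harm n) \<longlonglongrightarrow> L"
proof -
  define b where "b k = a k - L" for k
  have b: "b \<longlonglongrightarrow> 0" unfolding b_def using assms by (simp add: LIM_zero)
  have "(\<lambda>n. (\<Sum>k=1..n. b k / real k) / harm n) \<longlonglongrightarrow> 0"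
  proof (rule LIMSEQ_I)
    fix \<epsilon> :: real
    assume "0 < \<epsilon>"
    then obtain N where N: "\<And>k. k \<ge> N \<Longrightarrow> \<bar>b k\<bar> < \<epsilon> / 2"
      using LIMSEQ_D[OF b, of "\<epsilon> / 2"] by auto
    define c where "c = (\<Sum>k<N. \<bar>b k\<bar> / real k)"
    have "filterlim (harm :: nat \<Rightarrow> real) at_infinity sequentially"
      using harm_at_top by (rule filterlim_at_top_imp_at_infinity)
    then have "(\<lambda>n. c / harm n) \<longlonglongrightarrow> 0"
      by (rule tendsto_divide_0[OF tendsto_const])
    then have "\<forall>\<^sub>F n in sequentially. c / harm n < \<epsilon> / 2"
      using \<open>0 < \<epsilon>\<close> by (intro order_tendstoD(2)) auto
    then obtain n0 where n0: "\<And>n. n \<ge> n0 \<Longrightarrow> c / harm n < \<epsilon> / 2"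
      by (auto simp: eventually_sequentially)
    have "norm ((\<Sum>k=1..n. b k / real k) / harm n - 0) < \<epsilon>" if n: "n \<ge> max 1 n0" for n
    proof -
      have pos: "(harm n :: real) > 0" using n by simp
      have "\<bar>\<Sum>k=1..n. b k / real k\<bar> \<le> (\<Sum>k=1..n. \<bar>b k\<bar> / real k)"
        using sum_abs[of "\<lambda>k. b k / real k"] by (simp add: abs_divide)
      also have "\<dots> \<le> (\<Sum>k=1..n. (if k < N then \<bar>b k\<bar> / real k else 0) + \<epsilon> / 2 * inverse (real k))"
        using N \<open>0 < \<epsilon>\<close> by (intro sum_mono) (auto simp: field_simps not_less intro: less_imp_le)
      also have "\<dots> = (\<Sum>k=1..n. if k < N then \<bar>b k\<bar> / real k else 0) + \<epsilon> / 2 * harm n"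
        by (simp add: sum.distrib harm_def sum_distrib_left)
      also have "(\<Sum>k=1..n. if k < N then \<bar>b k\<bar> / real k else 0) = (\<Sum>k\<in>{1..n} \<inter> {..<N}. \<bar>b k\<bar> / real k)"
        by (subst sum.inter_restrict) (auto intro: sum.cong)
      also have "\<dots> \<le> c"
        unfolding c_def by (intro sum_mono2) auto
      finally have "\<bar>\<Sum>k=1..n. b k / real k\<bar> / harm n \<le> (c + \<epsilon> / 2 * harm n) / harm n"
        using pos by (intro divide_right_mono) (auto simp: harm_nonneg)
      also have "\<dots> = c / harm n + \<epsilon> / 2" using less_imp_neq[OF pos] by (simp add: add_divide_distrib)
      also have "\<dots> < \<epsilon>" using n0[of n] n by linarith
      finally show ?thesis by (simp add: abs_divide)
    qed
    then show "\<exists>no. \<forall>n\<ge>no. norm ((\<Sum>k=1..n. b k / real k) / harm n - 0) < \<epsilon>" by blast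
  qed
  from tendsto_add[OF this tendsto_const[of L]]
  have "(\<lambda>n. (\<Sum>k=1..n. b k / real k) / harm n + L) \<longlonglongrightarrow> L" by simp
  moreover have "\<forall>\<^sub>F n in sequentially. (\<Sum>k=1..n. b k / real k) / harm n + L = (\<Sum>k=1..n. a k / real k) / harm n"
    using eventually_gt_at_top[of 0]
  proof eventually_elim
    case (elim n)
    have "(\<Sum>k=1..n. b k / real k) = (\<Sum>k=1..n. a k / real k) - L * harm n"
      by (simp add: b_def left_diff_distrib sum_subtractf harm_def sum_distrib_left divide_inverse)
    moreover have "harm n \<noteq> (0 :: real)" using harm_pos[OF elim] by (rule less_imp_neq[symmetric])
    ultimately show ?case by (simp add: diff_divide_distrib)
  qed
  ultimately show ?thesis by (rule Lim_transform_eventually)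
qed

text \<open>If \<open>r i \<le> n \<le> r (Suc i)\<close>, monotonicity places
  \<open>W n / D n\<close> between \<open>W (r i) / D (r (Suc i))\<close> and
  \<open>W (r (Suc i)) / D (r i)\<close>. Both bounds tend to \<open>L\<close> because consecutive
  values of \<open>D\<close> along the subsequence have ratio tending to 1.\<close>

lemma tendsto_quotient_of_subsequence:
  fixes W D :: "nat \<Rightarrow> real" and r :: "nat \<Rightarrow> nat"
  assumes "mono W" "W 0 \<ge> 0" "mono D" "\<And>i. D (r i) > 0"
    and r: "filterlim r at_top sequentially"
    and ratio: "(\<lambda>i. D (r (Suc i)) / D (r i)) \<longlonglongrightarrow> 1"
    and lim: "(\<lambda>i. W (r i) / D (r i)) \<longlonglongrightarrow> L"
  shows "(\<lambda>n. W n / D n) \<longlonglongrightarrow> L"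
proof (rule LIMSEQ_I)
  fix \<epsilon> :: real
  assume "0 < \<epsilon>"
  have W0: "W n \<ge> 0" for n using assms(2) monoD[OF assms(1), of 0 n] by simp
  have "(\<lambda>i. W (r (Suc i)) / D (r (Suc i)) * (D (r (Suc i)) / D (r i))) \<longlonglongrightarrow> L * 1"
    by (intro tendsto_mult ratio LIMSEQ_Suc[OF lim])
  moreover have "W (r (Suc i)) / D (r (Suc i)) * (D (r (Suc i)) / D (r i)) = W (r (Suc i)) / D (r i)" for i
    using assms(4)[of i] assms(4)[of "Suc i"] by simp
  ultimately have up: "(\<lambda>i. W (r (Suc i)) / D (r i)) \<longlonglongrightarrow> L" by (simp only: mult_1_right)
  have "(\<lambda>i. W (r i) / D (r i) / (D (r (Suc i)) / D (r i))) \<longlonglongrightarrow> L / 1"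
    by (intro tendsto_divide ratio lim) simp
  moreover have "W (r i) / D (r i) / (D (r (Suc i)) / D (r i)) = W (r i) / D (r (Suc i))" for i
    using assms(4)[of i] assms(4)[of "Suc i"] by simp
  ultimately have lo: "(\<lambda>i. W (r i) / D (r (Suc i))) \<longlonglongrightarrow> L" by (simp only: div_by_1)
  have "\<forall>\<^sub>F i in sequentially. W (r (Suc i)) / D (r i) < L + \<epsilon> \<and> L - \<epsilon> < W (r i) / D (r (Suc i))"
    using order_tendstoD(2)[OF up, of "L + \<epsilon>"] order_tendstoD(1)[OF lo, of "L - \<epsilon>"] \<open>0 < \<epsilon>\<close>
    by (auto intro: eventually_conj)
  then obtain I where I: "\<And>i. i \<ge> I \<Longrightarrow> W (r (Suc i)) / D (r i) < L + \<epsilon>"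
    "\<And>i. i \<ge> I \<Longrightarrow> L - \<epsilon> < W (r i) / D (r (Suc i))"
    by (auto simp: eventually_sequentially)
  have "norm (W n / D n - L) < \<epsilon>" if n: "n \<ge> r I" for n
  proof -
    have "\<forall>\<^sub>F j in sequentially. Suc n \<le> r j \<and> I \<le> j"
      using r eventually_ge_at_top[of I] by (auto simp: filterlim_at_top intro: eventually_conj)
    then obtain k where k: "Suc n \<le> r k \<and> I \<le> k" by (auto simp: eventually_sequentially)
    \<comment> \<open>Since \<open>r\<close> need not be monotone, the bracket around
      \<open>n\<close> comes from the first \<open>j \<ge> I\<close> with \<open>r j > n\<close>: it
      is not \<open>I\<close> itself, so its predecessor \<open>i\<close> still satisfies
      \<open>i \<ge> I\<close> and \<open>r i \<le> n\<close>.\<close>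
    define j where "j = (LEAST j. Suc n \<le> r j \<and> I \<le> j)"
    have j: "Suc n \<le> r j" "I \<le> j" using LeastI[of "\<lambda>j. Suc n \<le> r j \<and> I \<le> j", OF k] by (auto simp: j_def)
    have "j \<noteq> I" using j(1) n by auto
    then obtain i where i: "j = Suc i" "i \<ge> I" using j(2) by (metis Suc_leI le_neq_implies_less less_imp_Suc_add le_add1)
    have "\<not> (Suc n \<le> r i \<and> I \<le> i)"
      by (rule not_less_Least) (use i in \<open>simp add: j_def[symmetric]\<close>)
    then have ri: "r i \<le> n" using i by simp
    have rj: "n \<le> r (Suc i)" using j i by simp
    have Dpos: "0 < D (r i)" "D (r i) \<le> D n" "D n \<le> D (r (Suc i))"
      using assms(4) monoD[OF assms(3)] ri rj by auto
    have "W n / D n \<le> W (r (Suc i)) / D (r i)"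
      using Dpos W0 monoD[OF assms(1) rj] by (intro frac_le) auto
    moreover have "W (r i) / D (r (Suc i)) \<le> W n / D n"
      using Dpos W0 monoD[OF assms(1) ri] by (intro frac_le) auto
    ultimately show ?thesis using I(1)[OF i(2)] I(2)[OF i(2)] by (simp add: abs_if)
  qed
  then show "\<exists>no. \<forall>n\<ge>no. norm (W n / D n - L) < \<epsilon>" by blast
qed

text \<open>Squares meet two competing demands: they grow fast enough for their reciprocals to be
  summable, as Borel-Cantelli requires, and slowly enough for consecutive ratios to tend to 1, as
  filling the gaps requires. The witness \<open>r i\<close> is the first index at which the harmonic
  numbers reach the square of \<open>i + 1\<close>.\<close>

lemma harm_subsequence:
  obtains r :: "nat \<Rightarrow> nat"
  where "filterlim r at_top sequentially"
    and "\<And>i. (real (Suc i))\<^sup>2 \<le> harm (r i)"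
    and "(\<lambda>i. harm (r (Suc i)) / harm (r i) :: real) \<longlonglongrightarrow> 1"
proof -
  define r where "r i = (LEAST n. (real (Suc i))\<^sup>2 \<le> harm n)" for i
  have ge: "(real (Suc i))\<^sup>2 \<le> harm (r i)" for i
  proof -
    have "\<forall>\<^sub>F n in sequentially. (real (Suc i))\<^sup>2 \<le> harm n"
      using harm_at_top by (auto simp: filterlim_at_top)
    then obtain n where "(real (Suc i))\<^sup>2 \<le> harm n" by (auto simp: eventually_sequentially)
    then show ?thesis unfolding r_def by (rule LeastI)
  qed
  have pos: "(harm (r i) :: real) > 0" for i
    by (rule less_le_trans[OF _ ge]) simp
  \<comment> \<open>The harmonic numbers grow by at most 1 per step, so the first value to reach the
    square overshoots it by less than 1.\<close>
  have lt: "harm (r i) < (real (Suc i))\<^sup>2 + 1" for i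
  proof -
    have "r i \<noteq> 0" using pos[of i] by (intro notI) (simp add: harm_def)
    then obtain p where p: "r i = Suc p" by (cases "r i") auto
    then have "\<not> (real (Suc i))\<^sup>2 \<le> harm p" using not_less_Least[of p "\<lambda>n. (real (Suc i))\<^sup>2 \<le> harm n"]
      unfolding r_def by simp
    moreover have "harm (Suc p) \<le> harm p + (1 :: real)" by (simp add: harm_Suc field_simps)
    ultimately show ?thesis unfolding p by linarith
  qed
  have "filterlim r at_top sequentially"
    unfolding filterlim_at_top
  proof
    fix Z
    obtain i0 where i0: "harm Z < real i0" using reals_Archimedean2 by blast
    have "Z \<le> r i" if "i \<ge> i0" for i
    proof (rule ccontr)
      assume "\<not> Z \<le> r i"
      then have "(harm (r i) :: real) \<le> harm Z" by (intro harm_mono) simp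
      also have "\<dots> < real (Suc i)" using i0 that by simp
      also have "\<dots> \<le> (real (Suc i))\<^sup>2" by (intro self_le_power) auto
      finally show False using ge[of i] by simp
    qed
    then show "\<forall>\<^sub>F i in sequentially. Z \<le> r i" by (auto simp: eventually_sequentially)
  qed
  moreover have "(\<lambda>i. harm (r (Suc i)) / harm (r i) :: real) \<longlonglongrightarrow> 1"
  proof (rule tendsto_sandwich)
    show "\<forall>\<^sub>F i in sequentially. 1 \<le> (harm (r (Suc i)) / harm (r i) :: real)"
    proof (rule always_eventually, rule allI)
      fix i
      have "(real (Suc i))\<^sup>2 + 1 \<le> (real (Suc (Suc i)))\<^sup>2" by (simp add: power2_eq_square algebra_simps)
      then have "(harm (r i) :: real) \<le> harm (r (Suc i))" using lt[of i] ge[of "Suc i"] by linarith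
      then show "1 \<le> (harm (r (Suc i)) / harm (r i) :: real)" using pos[of i] by simp
    qed
    show "\<forall>\<^sub>F i in sequentially. (harm (r (Suc i)) / harm (r i) :: real)
        \<le> 1 + 2 * inverse (real (Suc i)) + 2 * (inverse (real (Suc i)))\<^sup>2"
    proof (rule always_eventually, rule allI)
      fix i
      have sq: "((s + 1)\<^sup>2 + 1) / s\<^sup>2 = 1 + 2 * inverse s + 2 * (inverse s)\<^sup>2" if "s > 0" for s :: real
        using that by (simp add: field_simps power2_eq_square)
      have "(harm (r (Suc i)) / harm (r i) :: real) \<le> ((real (Suc i) + 1)\<^sup>2 + 1) / (real (Suc i))\<^sup>2"
        using lt[of "Suc i"] ge[of i] by (intro frac_le) (auto simp: add.commute)
      also have "\<dots> = 1 + 2 * inverse (real (Suc i)) + 2 * (inverse (real (Suc i)))\<^sup>2"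
        by (rule sq) simp
      finally show "(harm (r (Suc i)) / harm (r i) :: real)
        \<le> 1 + 2 * inverse (real (Suc i)) + 2 * (inverse (real (Suc i)))\<^sup>2" .
    qed
    have "(\<lambda>i. 1 + 2 * inverse (real (Suc i)) + 2 * (inverse (real (Suc i)))\<^sup>2) \<longlonglongrightarrow> 1 + 2 * 0 + 2 * 0\<^sup>2"
      by (intro tendsto_intros LIMSEQ_inverse_real_of_nat)
    then show "(\<lambda>i. 1 + 2 * inverse (real (Suc i)) + 2 * (inverse (real (Suc i)))\<^sup>2) \<longlonglongrightarrow> 1" by simp
  qed simp
  ultimately show thesis using that ge by blast
qed

text \<open>Chebyshev bounds the deviation probabilities by a multiple of
  \<open>1 / harm (r i)\<close>, which is summable along the subsequence of
  \<open>harm_subsequence\<close>. Borel-Cantelli then gives almost sure convergence along it, and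
  monotonicity of \<open>W\<close> extends this to all \<open>n\<close>.\<close>

lemma (in prob_space) AE_log_average_tendsto:
  fixes W :: "nat \<Rightarrow> 'a \<Rightarrow> real"
  assumes [measurable]: "\<And>n. W n \<in> borel_measurable M"
    and sq: "\<And>n. integrable M (\<lambda>\<omega>. (W n \<omega>)\<^sup>2)"
    and mono: "\<And>\<omega>. mono (\<lambda>n. W n \<omega>)" and nonneg: "\<And>\<omega>. 0 \<le> W 0 \<omega>"
    and var: "\<And>n. n \<ge> 1 \<Longrightarrow> variance (\<lambda>\<omega>. W n \<omega> / harm n) \<le> V / harm n"
    and lim: "(\<lambda>n. expectation (\<lambda>\<omega>. W n \<omega> / harm n)) \<longlonglongrightarrow> L"
  shows "AE \<omega> in M. (\<lambda>n. W n \<omega> / harm n) \<longlonglongrightarrow> L"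
proof -
  obtain r :: "nat \<Rightarrow> nat" where r: "filterlim r at_top sequentially"
    "\<And>i. (real (Suc i))\<^sup>2 \<le> harm (r i)" "(\<lambda>i. harm (r (Suc i)) / harm (r i) :: real) \<longlonglongrightarrow> 1"
    using harm_subsequence by blast
  have pos: "(harm (r i) :: real) > 0" for i
    by (rule less_le_trans[OF _ r(2)]) simp
  have r1: "r i \<ge> 1" for i using pos[of i] unfolding harm_pos_iff by simp
  \<comment> \<open>The sign of \<open>V\<close> is needed to replace \<open>harm (r i)\<close> in
    the denominator by the smaller square.\<close>
  have V: "V \<ge> 0"
  proof -
    have "0 \<le> variance (\<lambda>\<omega>. W 1 \<omega> / harm 1)" by (rule integral_nonneg_AE) simp
    also have "\<dots> \<le> V / harm 1" by (rule var) simp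
    finally show ?thesis by (simp add: harm_def)
  qed
  define F where "F i \<omega> = W (r i) \<omega> / harm (r i)" for i \<omega>
  have [measurable]: "F i \<in> borel_measurable M" for i unfolding F_def by measurable
  have dev: "AE \<omega> in M. \<forall>\<^sub>F i in sequentially. \<bar>F i \<omega> - expectation (F i)\<bar> < e" if "e > 0" for e
  proof -
    let ?A = "\<lambda>i. {\<omega> \<in> space M. e \<le> \<bar>F i \<omega> - expectation (F i)\<bar>}"
    have le: "prob (?A i) \<le> V / e\<^sup>2 * inverse (real (Suc i) ^ 2)" for i
    proof -
      have "prob (?A i) \<le> variance (F i) / e\<^sup>2"
        using sq[of "r i"] that by (intro Chebyshev_inequality) (auto simp: F_def power_divide)
      also have "\<dots> \<le> V / harm (r i) / e\<^sup>2"
        unfolding F_def using var[OF r1] by (intro divide_right_mono) auto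
      also have "\<dots> \<le> V / (real (Suc i))\<^sup>2 / e\<^sup>2"
        using V r(2) by (intro divide_right_mono divide_left_mono mult_pos_pos pos) auto
      finally show ?thesis by (simp add: field_simps)
    qed
    have "summable (\<lambda>i. V / e\<^sup>2 * inverse (real (Suc i) ^ 2))"
      by (intro summable_mult, subst summable_Suc_iff) (rule inverse_power_summable, simp)
    then have "summable (\<lambda>i. prob (?A i))"
      by (rule summable_comparison_test'[where N = 0]) (use le in simp)
    then have "AE \<omega> in M. \<forall>\<^sub>F i in sequentially. \<omega> \<in> space M - ?A i"
      by (intro borel_cantelli_AE1) (auto simp: emeasure_eq_measure)
    then show ?thesis
      by eventually_elim (auto elim!: eventually_mono)
  qed
  \<comment> \<open>The null set in \<open>dev\<close> depends on \<open>e\<close>; the countable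
    family \<open>e = 1 / (m + 1)\<close> gives a common one.\<close>
  have "AE \<omega> in M. \<forall>m. \<forall>\<^sub>F i in sequentially. \<bar>F i \<omega> - expectation (F i)\<bar> < inverse (real (Suc m))"
    by (subst AE_all_countable) (intro allI dev, simp)
  then show ?thesis
  proof eventually_elim
    case (elim \<omega>)
    have "(\<lambda>i. F i \<omega> - expectation (F i)) \<longlonglongrightarrow> 0"
    proof (rule tendstoI)
      fix e :: real
      assume "e > 0"
      then obtain m where "inverse (real (Suc m)) < e" using reals_Archimedean by blast
      with elim[rule_format, of m] show "\<forall>\<^sub>F i in sequentially. dist (F i \<omega> - expectation (F i)) 0 < e"
        by (auto elim!: eventually_mono simp: dist_real_def)
    qed
    moreover have "(\<lambda>i. expectation (F i)) \<longlonglongrightarrow> L"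
      unfolding F_def using filterlim_compose[OF lim r(1)] .
    ultimately have "(\<lambda>i. F i \<omega> - expectation (F i) + expectation (F i)) \<longlonglongrightarrow> 0 + L"
      by (rule tendsto_add)
    then have "(\<lambda>i. W (r i) \<omega> / harm (r i)) \<longlonglongrightarrow> L" by (simp add: F_def)
    then show ?case
      by (intro tendsto_quotient_of_subsequence[OF mono nonneg _ pos r(1) r(3)])
        (auto intro!: monoI harm_mono)
  qed
qed

section \<open>Weak convergence and the normal distribution\<close>

text \<open>The excess over \<open>R\<close> vanishes where \<open>f \<le> R\<close>, and elsewhere
  it is at most \<open>f\<close>, which is then at most \<open>f\<^sup>2 / R\<close>.\<close>

lemma (in prob_space) expectation_truncation_error:
  fixes f :: "'a \<Rightarrow> real"
  assumes [measurable]: "f \<in> borel_measurable M" and nonneg: "\<And>x. 0 \<le> f x"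
    and sq: "integrable M (\<lambda>x. (f x)\<^sup>2)" and "R > 0"
  shows "\<bar>expectation f - expectation (\<lambda>x. min (f x) R)\<bar> \<le> expectation (\<lambda>x. (f x)\<^sup>2) / R"
proof -
  have i: "integrable M f" using sq by (rule square_integrable_imp_integrable[rotated]) simp
  have m: "integrable M (\<lambda>x. min (f x) R)"
    by (rule Bochner_Integration.integrable_bound[OF i]) (use nonneg \<open>R > 0\<close> in auto)
  have pw: "0 \<le> f x - min (f x) R" "f x - min (f x) R \<le> (f x)\<^sup>2 / R" for x
  proof -
    show "f x - min (f x) R \<le> (f x)\<^sup>2 / R"
    proof (cases "f x \<le> R")
      case False
      then have "f x * R \<le> f x * f x" using nonneg[of x] by (intro mult_left_mono) auto
      then have "f x \<le> (f x)\<^sup>2 / R" using \<open>R > 0\<close> by (simp add: field_simps power2_eq_square)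
      then show ?thesis using False \<open>R > 0\<close> by simp
    qed (use \<open>R > 0\<close> in simp)
  qed simp
  have "0 \<le> expectation (\<lambda>x. f x - min (f x) R)" using pw by (intro integral_nonneg_AE) auto
  moreover have "expectation (\<lambda>x. f x - min (f x) R) \<le> expectation (\<lambda>x. (f x)\<^sup>2 / R)"
    using i m sq pw by (intro integral_mono) auto
  ultimately show ?thesis using i m by simp
qed

text \<open>Weak convergence handles only bounded continuous functions. The second moment bound
  makes the error of truncating the unbounded \<open>f\<close> uniformly small in
  \<open>n\<close>.\<close>

lemma weak_conv_m_integral_tendsto:
  fixes \<mu> :: "nat \<Rightarrow> real measure" and f :: "real \<Rightarrow> real"
  assumes \<mu>: "\<And>n. real_distribution (\<mu> n)" and \<nu>: "real_distribution \<nu>"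
    and conv: "weak_conv_m \<mu> \<nu>"
    and cont: "\<And>x. isCont f x" and nonneg: "\<And>x. 0 \<le> f x"
    and \<mu>2: "\<And>n. integrable (\<mu> n) (\<lambda>x. (f x)\<^sup>2)" "\<And>n. (\<integral>x. (f x)\<^sup>2 \<partial>\<mu> n) \<le> B"
    and \<nu>2: "integrable \<nu> (\<lambda>x. (f x)\<^sup>2)"
  shows "(\<lambda>n. \<integral>x. f x \<partial>\<mu> n) \<longlonglongrightarrow> (\<integral>x. f x \<partial>\<nu>)"
proof (rule LIMSEQ_I)
  fix \<epsilon> :: real
  assume "0 < \<epsilon>"
  interpret \<nu>: real_distribution \<nu> by fact
  have [measurable]: "f \<in> borel_measurable borel"
    using cont by (intro borel_measurable_continuous_onI continuous_at_imp_continuous_on) auto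
  \<comment> \<open>\<open>C\<close> bounds the second moments of all the measures involved, and the
    entry 1 keeps it positive. With this \<open>R\<close> each truncation error is at most
    \<open>\<epsilon> / 4\<close>, so two of them and the \<open>\<epsilon> / 4\<close> for the
    truncated integrals stay below \<open>\<epsilon>\<close>.\<close>
  define C where "C = max 1 (max B (\<integral>x. (f x)\<^sup>2 \<partial>\<nu>))"
  define R where "R = 4 * C / \<epsilon>"
  have "R > 0" "C > 0" using \<open>0 < \<epsilon>\<close> by (auto simp: R_def C_def)
  have CR: "C / R = \<epsilon> / 4" using \<open>0 < \<epsilon>\<close> \<open>C > 0\<close> by (simp add: R_def)
  have t: "\<bar>(\<integral>x. f x \<partial>N) - (\<integral>x. min (f x) R \<partial>N)\<bar> \<le> \<epsilon> / 4"
    if N: "real_distribution N" "integrable N (\<lambda>x. (f x)\<^sup>2)" "(\<integral>x. (f x)\<^sup>2 \<partial>N) \<le> C" for N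
  proof -
    interpret N: real_distribution N by fact
    have "\<bar>(\<integral>x. f x \<partial>N) - (\<integral>x. min (f x) R \<partial>N)\<bar> \<le> (\<integral>x. (f x)\<^sup>2 \<partial>N) / R"
      using nonneg N(2) \<open>R > 0\<close> by (intro N.expectation_truncation_error) auto
    also have "\<dots> \<le> C / R" using N(3) \<open>R > 0\<close> by (intro divide_right_mono) auto
    finally show ?thesis by (simp add: CR)
  qed
  have "(\<lambda>n. \<integral>x. min (f x) R \<partial>\<mu> n) \<longlonglongrightarrow> (\<integral>x. min (f x) R \<partial>\<nu>)"
  proof (rule weak_conv_imp_integral_bdd_continuous_conv[OF \<mu> \<nu> conv, where B = R])
    show "isCont (\<lambda>x. min (f x) R) x" for x using cont by (intro continuous_intros) auto
    show "norm (min (f x) R) \<le> R" for x using nonneg[of x] \<open>R > 0\<close> by auto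
  qed
  then obtain n0 where n0: "\<And>n. n \<ge> n0 \<Longrightarrow> \<bar>(\<integral>x. min (f x) R \<partial>\<mu> n) - (\<integral>x. min (f x) R \<partial>\<nu>)\<bar> < \<epsilon> / 4"
    using LIMSEQ_D[of _ _ "\<epsilon> / 4"] \<open>0 < \<epsilon>\<close> by (metis divide_pos_pos real_norm_def zero_less_numeral)
  have "norm ((\<integral>x. f x \<partial>\<mu> n) - (\<integral>x. f x \<partial>\<nu>)) < \<epsilon>" if "n \<ge> n0" for n
  proof -
    have "(\<integral>x. (f x)\<^sup>2 \<partial>\<mu> n) \<le> C" "(\<integral>x. (f x)\<^sup>2 \<partial>\<nu>) \<le> C"
      using \<mu>2(2)[of n] by (auto simp: C_def)
    then show ?thesis
      using t[OF \<mu> \<mu>2(1), of n] t[OF \<nu> \<nu>2] n0[OF that] \<open>0 < \<epsilon>\<close> unfolding real_norm_def by linarith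
  qed
  then show "\<exists>no. \<forall>n\<ge>no. norm ((\<integral>x. f x \<partial>\<mu> n) - (\<integral>x. f x \<partial>\<nu>)) < \<epsilon>" by blast
qed

text \<open>Substitution of \<open>\<sigma> * z\<close> for \<open>x\<close>; it transfers integrals
  against the limit law to the standard normal law in which the central limit theorem is
  expressed.\<close>

lemma integral_normal_density_scale:
  fixes f :: "real \<Rightarrow> real"
  assumes "\<sigma> > 0" and [measurable]: "f \<in> borel_measurable borel"
  shows "(\<integral>x. f x \<partial>density lborel (normal_density 0 \<sigma>)) = (\<integral>z. f (\<sigma> * z) \<partial>std_normal_distribution)"
proof -
  have "(\<integral>x. f x \<partial>density lborel (normal_density 0 \<sigma>)) = (\<integral>x. normal_density 0 \<sigma> x * f x \<partial>lborel)"
    by (subst integral_density) auto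
  also have "\<dots> = \<bar>\<sigma>\<bar> *\<^sub>R (\<integral>z. normal_density 0 \<sigma> (0 + \<sigma> * z) * f (0 + \<sigma> * z) \<partial>lborel)"
    by (rule lborel_integral_real_affine) (use \<open>\<sigma> > 0\<close> in simp)
  also have "\<dots> = (\<integral>z. \<sigma> * normal_density 0 \<sigma> (\<sigma> * z) * f (\<sigma> * z) \<partial>lborel)"
    using \<open>\<sigma> > 0\<close> by (simp add: mult.assoc)
  also have "(\<lambda>z. \<sigma> * normal_density 0 \<sigma> (\<sigma> * z)) = std_normal_density"
    using \<open>\<sigma> > 0\<close> by (auto simp: normal_density_def real_sqrt_mult power_mult_distrib)
  also have "(\<integral>z. std_normal_density z * f (\<sigma> * z) \<partial>lborel) = (\<integral>z. f (\<sigma> * z) \<partial>std_normal_distribution)"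
    by (subst integral_density) auto
  finally show ?thesis .
qed

lemma cdf_std_normal_distribution:
  "cdf std_normal_distribution t = 1 / sqrt (2 * pi) * (LBINT \<xi>:{..t}. exp (- \<xi>\<^sup>2 / 2))"
proof -
  interpret real_distribution std_normal_distribution by (rule real_dist_normal_dist)
  have "cdf std_normal_distribution t = (\<integral>x. indicator {..t} x \<partial>std_normal_distribution)"
    by (simp add: cdf_def)
  also have "\<dots> = (\<integral>x. std_normal_density x * indicator {..t} x \<partial>lborel)"
    by (subst integral_density) auto
  also have "\<dots> = (\<integral>x. 1 / sqrt (2 * pi) * (indicator {..t} x *\<^sub>R exp (- x\<^sup>2 / 2)) \<partial>lborel)"
    by (intro Bochner_Integration.integral_cong) (auto simp: std_normal_density_def)
  also have "\<dots> = 1 / sqrt (2 * pi) * (LBINT \<xi>:{..t}. exp (- \<xi>\<^sup>2 / 2))"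
    unfolding set_lebesgue_integral_def by (rule integral_mult_right_zero)
  finally show ?thesis .
qed

section \<open>Consequences of the Devroye inequality\<close>

text \<open>The lower bound is not automatic, since a supremum over the empty set would be
  \<open>-\<infinity>\<close> in \<open>ereal\<close>. The class \<open>perfect_space\<close>
  supplies a point different from \<open>x j\<close>.\<close>

lemma partial_holder_const_bounds:
  fixes K :: "(nat \<Rightarrow> 'b::{real_normed_vector,perfect_space}) \<Rightarrow> real"
  assumes "\<And>x y. \<bar>K x - K (x(j := y))\<bar> \<le> c * norm (x j - y) powr \<eta>"
  shows "0 \<le> partial_holder_const n \<eta> K j" "partial_holder_const n \<eta> K j \<le> ereal c"
proof -
  let ?x = "\<lambda>i\<in>{1..n}. (0 :: 'b)"
  obtain y where y: "y \<noteq> ?x j" using UNIV_not_singleton[of "?x j"] by blast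
  show "0 \<le> partial_holder_const n \<eta> K j"
    unfolding partial_holder_const_def
    by (rule SUP_upper2[where i = ?x], simp, rule SUP_upper2[where i = y]) (use y in auto)
  show "partial_holder_const n \<eta> K j \<le> ereal c"
    unfolding partial_holder_const_def
  proof (intro SUP_least)
    fix x :: "nat \<Rightarrow> 'b" and y
    assume "y \<in> - {x j}"
    then have "norm (x j - y) powr \<eta> > 0" by simp
    then show "ereal (\<bar>K x - K (x(j := y))\<bar> / norm (x j - y) powr \<eta>) \<le> ereal c"
      using assms[of x y] by (simp add: field_simps)
  qed
qed

text \<open>Trades the extended-real suprema for explicit real bounds \<open>c j\<close>. The order
  of quantifiers keeps \<open>D\<close> independent of \<open>n\<close>, \<open>K\<close> and
  \<open>c\<close>.\<close>

lemma devroye_variance_le: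
  fixes X :: "nat \<Rightarrow> 'a \<Rightarrow> 'b::{real_normed_vector,perfect_space}"
  assumes "devroye_inequality M X" "0 < \<eta>" "\<eta> \<le> 1"
  shows "\<exists>D>0. \<forall>n\<ge>1. \<forall>K c.
      (\<forall>j\<in>{1..n}. \<forall>x y. \<bar>K x - K (x(j := y))\<bar> \<le> c j * norm (x j - y) powr \<eta>) \<longrightarrow>
      prob_space.variance M (\<lambda>\<omega>. K (\<lambda>i\<in>{1..n}. X i \<omega>)) \<le> D * (\<Sum>j=1..n. (c j)\<^sup>2)"
proof -
  obtain D where D: "D > 0 \<and> (\<forall>n\<ge>1. \<forall>K. separately_holder n \<eta> K \<longrightarrow>
      prob_space.variance M (\<lambda>\<omega>. K (\<lambda>i\<in>{1..n}. X i \<omega>))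
        \<le> D * (\<Sum>j=1..n. (real_of_ereal (partial_holder_const n \<eta> K j))\<^sup>2))"
    using assms(1)[unfolded devroye_inequality_def, rule_format, OF conjI[OF assms(2,3)]] by (rule exE)
  have "prob_space.variance M (\<lambda>\<omega>. K (\<lambda>i\<in>{1..n}. X i \<omega>)) \<le> D * (\<Sum>j=1..n. (c j)\<^sup>2)"
    if n: "n \<ge> 1" and K: "\<And>j x y. j \<in> {1..n} \<Longrightarrow> \<bar>K x - K (x(j := y))\<bar> \<le> c j * norm (x j - y) powr \<eta>" for n K c
  proof -
    note b = partial_holder_const_bounds[where n = n, OF K]
    have "separately_holder n \<eta> K"
      unfolding separately_holder_def by (intro ballI, rule le_less_trans[OF b(2)]) auto
    then have "prob_space.variance M (\<lambda>\<omega>. K (\<lambda>i\<in>{1..n}. X i \<omega>))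
        \<le> D * (\<Sum>j=1..n. (real_of_ereal (partial_holder_const n \<eta> K j))\<^sup>2)"
      by (rule D[THEN conjunct2, rule_format, OF n])
    also have "\<dots> \<le> D * (\<Sum>j=1..n. (c j)\<^sup>2)"
    proof (intro mult_left_mono sum_mono power_mono)
      fix j assume j: "j \<in> {1..n}"
      show "0 \<le> real_of_ereal (partial_holder_const n \<eta> K j)"
        by (rule real_of_ereal_pos[OF b(1)[OF j]])
      show "real_of_ereal (partial_holder_const n \<eta> K j) \<le> c j"
        using b[OF j] by (cases "partial_holder_const n \<eta> K j") auto
    qed (use D in simp)
    finally show ?thesis .
  qed
  with conjunct1[OF D] show ?thesis by (intro exI[of _ D] conjI allI impI) auto
qed

text \<open>With \<open>s = sqrt k\<close> and \<open>t = sqrt (k + 1)\<close> one has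
  \<open>1 / s - 1 / t = 1 / (s * t * (s + t))\<close>, and \<open>t \<le> 2 * s\<close> yields
  \<open>t * (s + t) \<le> 4 * s\<^sup>2\<close>. The constant 4 is therefore enough for a
  telescoping bound.\<close>

lemma inverse_power_three_halves_le:
  assumes "k \<ge> 1"
  shows "1 / (real k * sqrt (real k)) \<le> 4 / sqrt (real k) - 4 / sqrt (real (Suc k))"
proof -
  define s t where "s = sqrt (real k)" and "t = sqrt (real (Suc k))"
  have s: "s \<ge> 1" "s\<^sup>2 = real k" using assms by (auto simp: s_def)
  have t: "t > 0" "t\<^sup>2 = s\<^sup>2 + 1" "s < t" by (auto simp: s_def t_def)
  have s1: "1 \<le> s\<^sup>2" using s(1) by (simp add: power2_eq_square mult_ge1_I)
  have "t\<^sup>2 \<le> (2 * s)\<^sup>2" using t(2) s1 by (simp add: power_mult_distrib)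
  then have "t \<le> 2 * s" by (rule power2_le_imp_le) (use s(1) in simp)
  then have "s * t \<le> s * (2 * s)" using s(1) by (intro mult_left_mono) auto
  then have "t * (s + t) \<le> 4 * s\<^sup>2" using t(2) s1 by (simp add: power2_eq_square algebra_simps)
  then have *: "s * (t * (s + t)) \<le> s * (4 * s\<^sup>2)" using s(1) by (intro mult_left_mono) auto
  have "(t - s) * (s + t) = 1" using t(2) by (simp add: power2_eq_square algebra_simps)
  then have "t - s = 1 / (s + t)" using s(1) t(1) by (simp add: eq_divide_eq)
  moreover have "4 / s - 4 / t = 4 * (t - s) / (s * t)" using s(1) t(1) by (simp add: field_simps)
  ultimately have "4 / s - 4 / t = 4 / (s * (t * (s + t)))" by (simp add: mult.assoc mult.commute)
  moreover have "1 / (s\<^sup>2 * s) = 4 / (s * (4 * s\<^sup>2))" using s(1) by simp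
  moreover have "4 / (s * (4 * s\<^sup>2)) \<le> 4 / (s * (t * (s + t)))"
    using * s(1) t(1) by (intro divide_left_mono) auto
  ultimately have "1 / (s\<^sup>2 * s) \<le> 4 / s - 4 / t" by linarith
  then show ?thesis unfolding s(2) unfolding s_def t_def .
qed

text \<open>Controls, uniformly in \<open>n\<close>, the total weight with which the
  \<open>j\<close>-th variable enters a logarithmic average.\<close>

lemma sum_inverse_power_three_halves_le:
  assumes "j \<ge> 1"
  shows "(\<Sum>k=j..n. 1 / (real k * sqrt (real k))) \<le> 4 / sqrt (real j)"
proof -
  have *: "(\<Sum>k=j..<j+p. 1 / (real k * sqrt (real k))) \<le> 4 / sqrt (real j) - 4 / sqrt (real (j + p))" for p
  proof (induction p)
    case (Suc p)
    then show ?case using inverse_power_three_halves_le[of "j + p"] assms by simp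
  qed simp
  show ?thesis
  proof (cases "j \<le> n")
    case True
    then have eq: "{j..n} = {j..<j + (Suc n - j)}" by auto
    have "(\<Sum>k=j..n. 1 / (real k * sqrt (real k))) \<le> 4 / sqrt (real j) - 4 / sqrt (real (j + (Suc n - j)))"
      unfolding eq by (rule *)
    also have "\<dots> \<le> 4 / sqrt (real j)" by simp
    finally show ?thesis .
  qed simp
qed

lemma sum_fun_upd_diff:
  fixes u :: "'b \<Rightarrow> real" and x :: "nat \<Rightarrow> 'b"
  assumes "j \<ge> 1"
  shows "(\<Sum>i=1..k. u (x i)) - (\<Sum>i=1..k. u ((x(j := y)) i)) = (if j \<le> k then u (x j) - u y else 0)"
proof -
  have "(\<Sum>i=1..k. u (x i)) - (\<Sum>i=1..k. u ((x(j := y)) i)) = (\<Sum>i=1..k. if i = j then u (x j) - u y else 0)"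
    unfolding sum_subtractf[symmetric] by (intro sum.cong) auto
  then show ?thesis using assms by simp
qed

text \<open>Both bounds use the Devroye inequality with the Hoelder exponent of \<open>u\<close>.
  For \<open>S n\<close> every partial constant is at most \<open>C\<close>, which gives
  \<open>D * C\<^sup>2 * n\<close>; the logarithmic average costs a further factor 16. One
  \<open>V\<close> serves both bounds and all 1-Lipschitz \<open>f\<close>.\<close>

lemma devroye_variance_partial_sums:
  fixes X :: "nat \<Rightarrow> 'a \<Rightarrow> 'b::{real_normed_vector,perfect_space}"
  assumes dev: "devroye_inequality M X" and "holder_continuous u"
  defines "S \<equiv> partial_sum (\<lambda>k \<omega>. u (X k \<omega>))"
  shows "\<exists>V\<ge>0. (\<forall>n\<ge>1. prob_space.variance M (S n) \<le> V * real n) \<and>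
    (\<forall>n\<ge>1. \<forall>f. 1-lipschitz_on UNIV f \<longrightarrow>
      prob_space.variance M (\<lambda>\<omega>. (\<Sum>k=1..n. f (S k \<omega> / sqrt (real k)) / real k) / harm n) \<le> V / harm n)"
proof -
  obtain \<beta> C0 where \<beta>: "0 < \<beta>" "\<beta> \<le> 1" and C0: "\<And>x y. \<bar>u x - u y\<bar> \<le> C0 * dist x y powr \<beta>"
    using assms(2) unfolding holder_continuous_def by blast
  define C where "C = max C0 0"
  have C: "\<bar>u x - u y\<bar> \<le> C * norm (x - y) powr \<beta>" for x y
    using C0[of x y] mult_right_mono[of C0 C "norm (x - y) powr \<beta>"] by (simp add: C_def dist_norm)
  obtain D where "D > 0 \<and> (\<forall>n\<ge>1. \<forall>K c.
      (\<forall>j\<in>{1..n}. \<forall>x y. \<bar>K x - K (x(j := y))\<bar> \<le> c j * norm (x j - y) powr \<beta>) \<longrightarrow>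
      prob_space.variance M (\<lambda>\<omega>. K (\<lambda>i\<in>{1..n}. X i \<omega>)) \<le> D * (\<Sum>j=1..n. (c j)\<^sup>2))"
    using devroye_variance_le[OF dev \<beta>] by (rule exE)
  note D = conjunct1[OF this] conjunct2[OF this, rule_format]
  define V where "V = 16 * D * C\<^sup>2"
  \<comment> \<open>For \<open>k \<le> n\<close> the sum reads only coordinates in
    \<open>{1..n}\<close>, so restricting the path does not change it.\<close>
  have S: "S k \<omega> = (\<Sum>i=1..k. u ((\<lambda>i\<in>{1..n}. X i \<omega>) i))" if "k \<le> n" for k n \<omega>
    unfolding S_def partial_sum_def using that by (intro sum.cong) auto
  show ?thesis
  proof (intro exI[of _ V] conjI allI impI)
    show "V \<ge> 0" using D(1) by (simp add: V_def)
  next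
    fix n :: nat
    assume n: "n \<ge> 1"
    have "prob_space.variance M (\<lambda>\<omega>. (\<lambda>x. \<Sum>i=1..n. u (x i)) (\<lambda>i\<in>{1..n}. X i \<omega>)) \<le> D * (\<Sum>j=1..n. C\<^sup>2)"
    proof (rule D(2)[OF n])
      fix j x y assume "j \<in> {1..n}"
      then show "\<bar>(\<Sum>i=1..n. u (x i)) - (\<Sum>i=1..n. u ((x(j := y)) i))\<bar> \<le> C * norm (x j - y) powr \<beta>"
        using C by (subst sum_fun_upd_diff) auto
    qed
    also have "\<dots> \<le> V * real n" using D(1) by (simp add: V_def)
    finally show "prob_space.variance M (S n) \<le> V * real n"
      by (simp add: S_def partial_sum_def[abs_def])
  next
    fix n :: nat and f :: "real \<Rightarrow> real"
    assume n: "n \<ge> 1" and f: "1-lipschitz_on UNIV f"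
    have h: "(harm n :: real) > 0" using n by simp
    have lip: "\<bar>f s - f t\<bar> \<le> \<bar>s - t\<bar>" for s t
      using lipschitz_onD[OF f, of s t] by (simp add: dist_real_def)
    \<comment> \<open>Changing \<open>x\<^sub>j\<close> moves only the sums \<open>S\<^sub>k\<close> with \<open>k \<ge> j\<close>, so the \<open>j\<close>-th Hoelder constant is of
      order \<open>j\<^sup>-\<^sup>1\<^sup>/\<^sup>2 / D\<^sub>n\<close>, and the squares sum up to order \<open>1 / D\<^sub>n\<close>.\<close>
    define K where "K x = (\<Sum>k=1..n. f ((\<Sum>i=1..k. u (x i)) / sqrt (real k)) / real k) / harm n" for x
    define c where "c j = 4 * C / (sqrt (real j) * harm n)" for j
    have "prob_space.variance M (\<lambda>\<omega>. K (\<lambda>i\<in>{1..n}. X i \<omega>)) \<le> D * (\<Sum>j=1..n. (c j)\<^sup>2)"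
    proof (rule D(2)[OF n])
      fix j x y assume j: "j \<in> {1..n}"
      let ?x' = "x(j := y)" and ?d = "\<bar>u (x j) - u y\<bar>"
      have "\<bar>K x - K ?x'\<bar> = \<bar>\<Sum>k=1..n. (f ((\<Sum>i=1..k. u (x i)) / sqrt (real k)) - f ((\<Sum>i=1..k. u (?x' i)) / sqrt (real k))) / real k\<bar> / harm n"
        using h unfolding K_def diff_divide_distrib[symmetric] sum_subtractf[symmetric] by (simp add: abs_divide)
      \<comment> \<open>The weight \<open>1 / k\<close> and the normalisation
        \<open>1 / sqrt k\<close> inside the Lipschitz function combine to
        \<open>1 / (k * sqrt k)\<close>.\<close>
      also have "\<dots> \<le> (\<Sum>k=1..n. if j \<le> k then ?d * (1 / (real k * sqrt (real k))) else 0) / harm n"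
      proof (intro divide_right_mono order_trans[OF sum_abs] sum_mono)
        fix k assume k: "k \<in> {1..n}"
        let ?s = "\<Sum>i=1..k. u (x i)" and ?t = "\<Sum>i=1..k. u (?x' i)"
        have "\<bar>(f (?s / sqrt (real k)) - f (?t / sqrt (real k))) / real k\<bar> \<le> \<bar>?s / sqrt (real k) - ?t / sqrt (real k)\<bar> / real k"
          using lip by (simp add: abs_divide divide_right_mono)
        also have "\<dots> = \<bar>?s - ?t\<bar> * (1 / (real k * sqrt (real k)))"
          unfolding diff_divide_distrib[symmetric] by (simp add: abs_divide)
        also have "\<dots> = (if j \<le> k then ?d * (1 / (real k * sqrt (real k))) else 0)"
          using j by (subst sum_fun_upd_diff) auto
        finally show "\<bar>(f (?s / sqrt (real k)) - f (?t / sqrt (real k))) / real k\<bar>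
          \<le> (if j \<le> k then ?d * (1 / (real k * sqrt (real k))) else 0)" .
      qed (rule harm_nonneg)
      also have "(\<Sum>k=1..n. if j \<le> k then ?d * (1 / (real k * sqrt (real k))) else 0)
          = ?d * (\<Sum>k=j..n. 1 / (real k * sqrt (real k)))"
        unfolding sum_distrib_left using j by (intro sum.mono_neutral_cong_right) auto
      also have "?d * (\<Sum>k=j..n. 1 / (real k * sqrt (real k))) / harm n
          \<le> (C * norm (x j - y) powr \<beta>) * (4 / sqrt (real j)) / harm n"
        using j h C by (intro divide_right_mono mult_mono sum_inverse_power_three_halves_le sum_nonneg) (auto simp: C_def harm_nonneg)
      also have "\<dots> = c j * norm (x j - y) powr \<beta>" by (simp add: c_def)
      finally show "\<bar>K x - K ?x'\<bar> \<le> c j * norm (x j - y) powr \<beta>" .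
    qed
    also have "(\<Sum>j=1..n. (c j)\<^sup>2) = (\<Sum>j=1..n. 16 * C\<^sup>2 / (harm n)\<^sup>2 * inverse (real j))"
      by (intro sum.cong) (auto simp: c_def power_divide power_mult_distrib field_simps)
    also have "\<dots> = 16 * C\<^sup>2 / (harm n)\<^sup>2 * harm n"
      by (simp add: harm_def sum_distrib_left)
    also have "D * \<dots> = V / harm n" using less_imp_neq[OF h] by (simp add: V_def power2_eq_square)
    finally have "prob_space.variance M (\<lambda>\<omega>. K (\<lambda>i\<in>{1..n}. X i \<omega>)) \<le> V / harm n" .
    moreover have "K (\<lambda>i\<in>{1..n}. X i \<omega>) = (\<Sum>k=1..n. f (S k \<omega> / sqrt (real k)) / real k) / harm n" for \<omega>
      unfolding K_def by (intro arg_cong2[where f = "(/)"] sum.cong refl) (simp add: S[of _ n])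
    ultimately show "prob_space.variance M (\<lambda>\<omega>. (\<Sum>k=1..n. f (S k \<omega> / sqrt (real k)) / real k) / harm n) \<le> V / harm n"
      by simp
  qed
qed

lemma holder_continuous_imp_continuous_on:
  fixes u :: "'b::metric_space \<Rightarrow> real"
  assumes "holder_continuous u"
  shows "continuous_on UNIV u"
proof -
  obtain \<beta> C where \<beta>: "0 < \<beta>" and C: "\<And>x y. \<bar>u x - u y\<bar> \<le> C * dist x y powr \<beta>"
    using assms unfolding holder_continuous_def by blast
  show ?thesis
    unfolding continuous_on_def
  proof (intro ballI)
    fix x :: 'b
    have "((\<lambda>y. dist y x) \<longlongrightarrow> dist x x) (at x)"
      by (intro tendsto_dist tendsto_ident_at tendsto_const)
    then have "((\<lambda>y. dist y x) \<longlongrightarrow> 0) (at x)" by simp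
    then have "((\<lambda>y. dist y x powr \<beta>) \<longlongrightarrow> 0) (at x)"
      by (rule tendsto_zero_powrI[OF _ tendsto_const]) (use \<beta> in auto)
    from tendsto_mult[OF tendsto_const this]
    have "((\<lambda>y. C * dist y x powr \<beta>) \<longlongrightarrow> 0) (at x)" by simp
    then have "((\<lambda>y. u y - u x) \<longlongrightarrow> 0) (at x)"
      by (rule Lim_null_comparison[rotated]) (use C in auto)
    then show "(u \<longlongrightarrow> u x) (at x within UNIV)" by (simp add: LIM_zero_iff)
  qed
qed

section \<open>The almost sure central limit theorem\<close>

lemma real_distribution_log_empirical_measure:
  assumes "n \<ge> 1"
  shows "real_distribution (log_empirical_measure Y n \<omega>)"
proof -
  have h: "(harm n :: real) > 0" using assms by simp
  have "emeasure (log_empirical_measure Y n \<omega>) UNIV = (\<Sum>k=1..n. ennreal (1 / harm n * (1 / real k)))"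
    by (subst emeasure_log_empirical_measure) auto
  also have "\<dots> = ennreal (\<Sum>k=1..n. 1 / harm n * (1 / real k))"
    by (intro sum_ennreal) (auto simp: harm_nonneg)
  also have "(\<Sum>k=1..n. 1 / harm n * (1 / real k)) = 1 / harm n * harm n"
    unfolding harm_def sum_distrib_left by (simp add: inverse_eq_divide)
  also have "\<dots> = 1" using less_imp_neq[OF h] by simp
  finally show ?thesis
    unfolding real_distribution_def real_distribution_axioms_def
    by (auto intro!: prob_spaceI simp: log_empirical_measure_def)
qed

text \<open>The measure is carried by finitely many atoms, so integrability is free. The formula
  also holds for \<open>n = 0\<close>, where both sides are 0.\<close>

lemma log_empirical_measure_integral:
  fixes f :: "real \<Rightarrow> real"
  assumes [measurable]: "f \<in> borel_measurable borel"
  shows "integrable (log_empirical_measure Y n \<omega>) f"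
    and "(\<integral>x. f x \<partial>log_empirical_measure Y n \<omega>)
      = (\<Sum>k=1..n. f (partial_sum Y k \<omega> / sqrt (real k)) / real k) / harm n"
proof -
  let ?g = "\<lambda>k. partial_sum Y k \<omega> / sqrt (real k)"
  let ?P = "point_measure {1..n} (\<lambda>k. ennreal (1 / harm n * (1 / real k)))"
  have [measurable]: "?g \<in> measurable ?P borel" by (simp add: measurable_point_measure_eq1)
  show "integrable (log_empirical_measure Y n \<omega>) f"
    unfolding log_empirical_measure_def
    by (subst integrable_distr_eq) (auto intro: integrable_point_measure_finite)
  have "(\<integral>x. f x \<partial>log_empirical_measure Y n \<omega>) = (\<integral>k. f (?g k) \<partial>?P)"
    unfolding log_empirical_measure_def by (subst integral_distr) auto
  also have "\<dots> = (\<Sum>k=1..n. (1 / harm n * (1 / real k)) *\<^sub>R f (?g k))"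
    by (rule lebesgue_integral_point_measure_finite) (auto simp: harm_nonneg)
  also have "\<dots> = (\<Sum>k=1..n. f (?g k) / real k) / harm n"
    by (simp add: sum_divide_distrib mult.commute)
  finally show "(\<integral>x. f x \<partial>log_empirical_measure Y n \<omega>)
      = (\<Sum>k=1..n. f (partial_sum Y k \<omega> / sqrt (real k)) / real k) / harm n" .
qed

theorem theorem8p1:
  fixes M :: "'a measure"
    and X :: "nat \<Rightarrow> 'a \<Rightarrow> real ^ 'd"
    and \<mu> :: "(real ^ 'd) measure"
    and A :: real
    and u :: "real ^ 'd \<Rightarrow> real"
    and \<sigma> :: real
  assumes "prob_space M"
    and "\<And>k. k \<ge> 1 \<Longrightarrow> X k \<in> borel_measurable M"
    and "stationary M X"
    and "ergodic M X"
    and "\<And>k. k \<ge> 1 \<Longrightarrow> distr M borel (X k) = \<mu>"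
    and "A > 0"
    and "\<And>k. k \<ge> 1 \<Longrightarrow> AE \<omega> in M. norm (X k \<omega>) \<le> A"
    and "devroye_inequality M X"
    and "holder_continuous u"
    and "(\<integral>x. u x \<partial>\<mu>) = 0"
    and "summable (\<lambda>l. \<bar>auto_covariance M (\<lambda>k \<omega>. u (X k \<omega>)) (l + 1)\<bar>)"
    and "\<sigma> \<ge> 0"
    and "\<sigma>\<^sup>2 = auto_covariance M (\<lambda>k \<omega>. u (X k \<omega>)) 1
               + 2 * (\<Sum>l. auto_covariance M (\<lambda>k \<omega>. u (X k \<omega>)) (l + 2))"
    and "\<sigma>\<^sup>2 \<noteq> 0"
    and "\<And>t::real. (\<lambda>n. measure M {\<omega> \<in> space M. (\<Sum>j=1..n. u (X j \<omega>)) / (\<sigma> * sqrt (real n)) \<le> t})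
           \<longlonglongrightarrow> 1 / sqrt (2 * pi) * (LBINT \<xi>:{..t}. exp (- \<xi>\<^sup>2 / 2))"
  shows "AE \<omega> in M.
    (\<lambda>n. kantorovich (log_empirical_measure (\<lambda>k \<omega>. u (X k \<omega>)) n \<omega>)
           (density lborel (normal_density 0 \<sigma>))) \<longlonglongrightarrow> 0"
proof -
  interpret prob_space M by fact
  note X_meas = assms(2) and X_law = assms(5) and X_bdd = assms(7)
    and dev = assms(8) and hol = assms(9) and mean = assms(10) and clt = assms(15)
  have \<sigma>: "\<sigma> > 0" using assms(12,14) by (cases "\<sigma> = 0") auto
  define S where "S = partial_sum (\<lambda>k \<omega>. u (X k \<omega>))"
  define G where "G = density lborel (normal_density 0 \<sigma>)"

  \<comment> \<open>Bounds and moments of the partial sums\<close>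
  have "continuous_on UNIV u" using hol by (rule holder_continuous_imp_continuous_on)
  then have u_meas[measurable]: "u \<in> borel_measurable borel"
    by (rule borel_measurable_continuous_onI)
  have Y_meas: "(\<lambda>\<omega>. u (X k \<omega>)) \<in> borel_measurable M" if "k \<ge> 1" for k
    using measurable_compose[OF X_meas[OF that] u_meas] .
  have S_meas[measurable]: "S n \<in> borel_measurable M" for n
    unfolding S_def partial_sum_def[abs_def] using Y_meas by (intro borel_measurable_sum) auto

  \<comment> \<open>Closed balls of \<open>real ^ 'd\<close> are compact, so the continuous
    \<open>u\<close> is bounded on the ball carrying the process.\<close>
  obtain b where b: "\<And>x. norm x \<le> A \<Longrightarrow> \<bar>u x\<bar> \<le> b"
    using compact_imp_bounded[OF compact_continuous_image[OF continuous_on_subset[OF \<open>continuous_on UNIV u\<close> subset_UNIV] compact_cball[of 0 A]]]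
    unfolding bounded_iff by (force simp: mem_cball_0)
  have Y_bdd: "AE \<omega> in M. \<bar>u (X k \<omega>)\<bar> \<le> b" if "k \<ge> 1" for k
    using X_bdd[OF that] by eventually_elim (rule b)
  have Y_int: "integrable M (\<lambda>\<omega>. u (X k \<omega>))" if "k \<ge> 1" for k
    using Y_bdd[OF that] Y_meas[OF that] by (intro integrable_const_bound[where B = b]) auto
  have Y_mean: "expectation (\<lambda>\<omega>. u (X k \<omega>)) = 0" if "k \<ge> 1" for k
    using integral_distr[OF X_meas[OF that] u_meas] X_law[OF that] mean by simp
  have S_bdd: "AE \<omega> in M. \<forall>n. \<bar>S n \<omega>\<bar> \<le> real n * b"
  proof -
    have "AE \<omega> in M. \<forall>k\<in>{1..}. \<bar>u (X k \<omega>)\<bar> \<le> b"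
      by (subst AE_ball_countable) (auto intro: Y_bdd)
    then show ?thesis
    proof eventually_elim
      case (elim \<omega>)
      have "\<bar>S n \<omega>\<bar> \<le> (\<Sum>j=1..n. b)" for n
        unfolding S_def partial_sum_def using elim by (intro order_trans[OF sum_abs] sum_mono) auto
      then show ?case by simp
    qed
  qed
  have S_mean: "expectation (S n) = 0" for n
    unfolding S_def partial_sum_def[abs_def] using Y_int Y_mean by (subst Bochner_Integration.integral_sum) auto
  have S_sq: "integrable M (\<lambda>\<omega>. (S n \<omega>)\<^sup>2)" for n
  proof (rule integrable_const_bound[where B = "(real n * b)\<^sup>2"])
    show "AE \<omega> in M. norm ((S n \<omega>)\<^sup>2) \<le> (real n * b)\<^sup>2"
      using S_bdd by eventually_elim (auto simp: abs_le_square_iff[symmetric] intro: order_trans)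
  qed simp

  obtain V where "0 \<le> V \<and> (\<forall>n\<ge>1. variance (S n) \<le> V * real n) \<and>
    (\<forall>n\<ge>1. \<forall>f. 1-lipschitz_on UNIV f \<longrightarrow>
      variance (\<lambda>\<omega>. (\<Sum>k=1..n. f (S k \<omega> / sqrt (real k)) / real k) / harm n) \<le> V / harm n)"
    unfolding S_def using devroye_variance_partial_sums[OF dev hol] by (rule exE)
  note V = conjunct1[OF this] conjunct1[OF conjunct2[OF this], rule_format]
    and V_log = conjunct2[OF conjunct2[OF this], rule_format]
  \<comment> \<open>The sums are centred, so the variance bound is a bound on second moments. The
    index 0, where the quotient is 0 by division by zero, is included because the weak convergence
    lemma asks for all \<open>n\<close>.\<close>
  have S_var: "expectation (\<lambda>\<omega>. (S n \<omega> / sqrt (real n))\<^sup>2) \<le> V" for n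
  proof (cases "n \<ge> 1")
    case True
    then have "expectation (\<lambda>\<omega>. (S n \<omega>)\<^sup>2) \<le> V * real n" using V(2)[of n] S_mean by simp
    then show ?thesis using True by (simp add: power_divide field_simps)
  next
    case False
    then have "n = 0" by simp
    then show ?thesis using V(1) by simp
  qed

  \<comment> \<open>Convergence of the means of the potentials\<close>
  have lip: "1-lipschitz_on UNIV (\<lambda>x :: real. \<bar>x - a\<bar>)" for a
    by (auto simp: lipschitz_on_def dist_real_def)

  have std: "(\<integral>x. \<bar>x - a\<bar> \<partial>G) = (\<integral>z. \<bar>\<sigma> * z - a\<bar> \<partial>std_normal_distribution)" for a
    unfolding G_def by (rule integral_normal_density_scale[OF \<sigma>]) simp

  have conv: "weak_conv_m (\<lambda>n. distr M borel (\<lambda>\<omega>. S n \<omega> / (\<sigma> * sqrt (real n)))) std_normal_distribution"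
    unfolding weak_conv_m_def weak_conv_def
  proof (intro allI impI)
    fix t
    have "cdf (distr M borel (\<lambda>\<omega>. S n \<omega> / (\<sigma> * sqrt (real n)))) t
        = measure M ((\<lambda>\<omega>. S n \<omega> / (\<sigma> * sqrt (real n))) -` {..t} \<inter> space M)" for n
      unfolding cdf_def by (rule measure_distr) simp_all
    moreover have "(\<lambda>\<omega>. S n \<omega> / (\<sigma> * sqrt (real n))) -` {..t} \<inter> space M
        = {\<omega> \<in> space M. (\<Sum>j=1..n. u (X j \<omega>)) / (\<sigma> * sqrt (real n)) \<le> t}" for n
      by (auto simp: S_def partial_sum_def)
    ultimately show "(\<lambda>n. cdf (distr M borel (\<lambda>\<omega>. S n \<omega> / (\<sigma> * sqrt (real n)))) t) \<longlonglongrightarrow> cdf std_normal_distribution t"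
      using clt[of t] by (simp only: cdf_std_normal_distribution)
  qed

  \<comment> \<open>The central limit theorem is normalised by \<open>\<sigma> * sqrt n\<close>, so
    weak convergence to the standard normal law is tested on
    \<open>\<bar>\<sigma> * z - a\<bar>\<close>. The squares of this function have integrals at most
    \<open>2 * V + 2 * a\<^sup>2\<close>, by \<open>pw\<close> and \<open>S_var\<close>.\<close>
  have E_lim: "(\<lambda>n. expectation (\<lambda>\<omega>. \<bar>S n \<omega> / sqrt (real n) - a\<bar>)) \<longlonglongrightarrow> (\<integral>x. \<bar>x - a\<bar> \<partial>G)" for a
  proof -
    let ?\<mu> = "\<lambda>n. distr M borel (\<lambda>\<omega>. S n \<omega> / (\<sigma> * sqrt (real n)))"
    have sc: "\<sigma> * (S n \<omega> / (\<sigma> * sqrt (real n))) = S n \<omega> / sqrt (real n)" for n \<omega>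
      using \<sigma> by simp
    have pw: "(\<bar>s - a\<bar>)\<^sup>2 \<le> 2 * s\<^sup>2 + 2 * a\<^sup>2" for s :: real
      using zero_le_power2[of "s + a"] by (simp add: power2_eq_square algebra_simps)
    have i2: "integrable M (\<lambda>\<omega>. 2 * (S n \<omega> / sqrt (real n))\<^sup>2 + 2 * a\<^sup>2)" for n
      using S_sq[of n] by (simp add: power_divide)
    have i1: "integrable M (\<lambda>\<omega>. (\<bar>S n \<omega> / sqrt (real n) - a\<bar>)\<^sup>2)" for n
      by (rule Bochner_Integration.integrable_bound[OF i2[of n]]) (use pw in auto)
    have "(\<lambda>n. \<integral>z. \<bar>\<sigma> * z - a\<bar> \<partial>?\<mu> n) \<longlonglongrightarrow> (\<integral>z. \<bar>\<sigma> * z - a\<bar> \<partial>std_normal_distribution)"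
    proof (rule weak_conv_m_integral_tendsto[OF _ real_dist_normal_dist conv, where B = "2 * V + 2 * a\<^sup>2"])
      show "integrable (?\<mu> n) (\<lambda>z. \<bar>\<sigma> * z - a\<bar>\<^sup>2)" for n
        using i1[of n] by (subst integrable_distr_eq) (simp_all only: sc, simp_all)
      show "(\<integral>z. \<bar>\<sigma> * z - a\<bar>\<^sup>2 \<partial>?\<mu> n) \<le> 2 * V + 2 * a\<^sup>2" for n
      proof -
        have "(\<integral>z. \<bar>\<sigma> * z - a\<bar>\<^sup>2 \<partial>?\<mu> n) = expectation (\<lambda>\<omega>. \<bar>S n \<omega> / sqrt (real n) - a\<bar>\<^sup>2)"
          by (subst integral_distr) (simp_all only: sc, simp_all)
        also have "\<dots> \<le> expectation (\<lambda>\<omega>. 2 * (S n \<omega> / sqrt (real n))\<^sup>2 + 2 * a\<^sup>2)"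
          by (rule integral_mono[OF i1 i2]) (rule pw)
        also have "\<dots> = 2 * expectation (\<lambda>\<omega>. (S n \<omega> / sqrt (real n))\<^sup>2) + 2 * a\<^sup>2"
          using S_sq[of n] by (simp add: power_divide prob_space)
        also have "\<dots> \<le> 2 * V + 2 * a\<^sup>2" using S_var[of n] by simp
        finally show ?thesis .
      qed
      \<comment> \<open>The expanded square, with its constant and linear terms as powers of
        \<open>z\<close> to match the moment lemma.\<close>
      have "integrable std_normal_distribution (\<lambda>z. \<sigma>\<^sup>2 * z ^ 2 + a\<^sup>2 * z ^ 0 - 2 * \<sigma> * a * z ^ 1)"
        by (intro Bochner_Integration.integrable_add Bochner_Integration.integrable_diff integrable_mult_right
            integrable_std_normal_distribution_moment)
      then show "integrable std_normal_distribution (\<lambda>z. \<bar>\<sigma> * z - a\<bar>\<^sup>2)"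
        by (simp add: power2_diff power_mult_distrib mult_ac)
      show "isCont (\<lambda>z. \<bar>\<sigma> * z - a\<bar>) z" for z by (intro continuous_intros)
    qed auto
    moreover have "(\<integral>z. \<bar>\<sigma> * z - a\<bar> \<partial>?\<mu> n) = expectation (\<lambda>\<omega>. \<bar>S n \<omega> / sqrt (real n) - a\<bar>)" for n
      by (subst integral_distr) (simp_all only: sc, simp_all)
    ultimately show ?thesis by (simp only: std)
  qed

  \<comment> \<open>Almost sure convergence of a single potential\<close>
  have AE_lim: "AE \<omega> in M. (\<lambda>n. \<integral>x. \<bar>x - a\<bar> \<partial>log_empirical_measure (\<lambda>k \<omega>. u (X k \<omega>)) n \<omega>)
      \<longlonglongrightarrow> (\<integral>x. \<bar>x - a\<bar> \<partial>G)" for a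
  proof -
    \<comment> \<open>For \<open>n \<ge> 1\<close> this is \<open>harm n\<close> times the integral
      of \<open>\<bar>x - a\<bar>\<close> against the empirical measure. Nonnegative summands make
      it monotone in \<open>n\<close>.\<close>
    define W where "W n \<omega> = (\<Sum>k=1..n. \<bar>S k \<omega> / sqrt (real k) - a\<bar> / real k)" for n \<omega>
    have W_meas[measurable]: "W n \<in> borel_measurable M" for n unfolding W_def by measurable
    have W_nonneg: "0 \<le> W n \<omega>" for n \<omega> unfolding W_def by (intro sum_nonneg) simp
    have i: "integrable M (\<lambda>\<omega>. \<bar>S n \<omega> / sqrt (real n) - a\<bar>)" for n
    proof -
      have "integrable M (S n)" using S_sq by (rule square_integrable_imp_integrable[rotated]) simp
      then show ?thesis by simp
    qed
    have "AE \<omega> in M. (\<lambda>n. W n \<omega> / harm n) \<longlonglongrightarrow> (\<integral>x. \<bar>x - a\<bar> \<partial>G)"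
    proof (rule AE_log_average_tendsto)
      show "integrable M (\<lambda>\<omega>. (W n \<omega>)\<^sup>2)" for n
      proof (rule integrable_const_bound)
        \<comment> \<open>This crude bound grows with \<open>n\<close> and serves only square
          integrability; the decay of the variance comes from \<open>V_log\<close>.\<close>
        show "AE \<omega> in M. norm ((W n \<omega>)\<^sup>2) \<le> (\<Sum>k=1..n. (real k * b / sqrt (real k) + \<bar>a\<bar>) / real k)\<^sup>2"
          using S_bdd
        proof eventually_elim
          case (elim \<omega>)
          have "W n \<omega> \<le> (\<Sum>k=1..n. (real k * b / sqrt (real k) + \<bar>a\<bar>) / real k)"
            unfolding W_def
          proof (intro sum_mono divide_right_mono)
            fix k
            have "\<bar>S k \<omega> / sqrt (real k) - a\<bar> \<le> \<bar>S k \<omega> / sqrt (real k)\<bar> + \<bar>a\<bar>" by (rule abs_triangle_ineq4)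
            also have "\<bar>S k \<omega> / sqrt (real k)\<bar> \<le> real k * b / sqrt (real k)"
              using elim[rule_format, of k] by (simp add: abs_divide divide_right_mono)
            finally show "\<bar>S k \<omega> / sqrt (real k) - a\<bar> \<le> real k * b / sqrt (real k) + \<bar>a\<bar>" by simp
          qed simp
          then show ?case using W_nonneg[of n \<omega>] by (simp add: power_mono)
        qed
      qed simp
      show "mono (\<lambda>n. W n \<omega>)" for \<omega>
        unfolding mono_iff_le_Suc by (simp add: W_def)
      show "variance (\<lambda>\<omega>. W n \<omega> / harm n) \<le> V / harm n" if "n \<ge> 1" for n
        unfolding W_def by (rule V_log[OF that lip])
      have E_W: "expectation (\<lambda>\<omega>. W n \<omega> / harm n)
          = (\<Sum>k=1..n. expectation (\<lambda>\<omega>. \<bar>S k \<omega> / sqrt (real k) - a\<bar>) / real k) / harm n" for n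
        unfolding W_def using i by (simp add: Bochner_Integration.integral_sum)
      show "(\<lambda>n. expectation (\<lambda>\<omega>. W n \<omega> / harm n)) \<longlonglongrightarrow> (\<integral>x. \<bar>x - a\<bar> \<partial>G)"
        unfolding E_W by (rule log_cesaro[OF E_lim])
    qed (use W_nonneg in auto)
    then show ?thesis
      by (simp add: log_empirical_measure_integral(2) W_def S_def)
  qed

  \<comment> \<open>Countability of the rationals gives one null set for all potentials, after which
    the argument is deterministic for each remaining \<open>\<omega>\<close>.\<close>
  have "AE \<omega> in M. \<forall>a\<in>\<rat>. (\<lambda>n. \<integral>x. \<bar>x - a\<bar> \<partial>log_empirical_measure (\<lambda>k \<omega>. u (X k \<omega>)) n \<omega>)
      \<longlonglongrightarrow> (\<integral>x. \<bar>x - a\<bar> \<partial>G)"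
    by (subst AE_ball_countable[OF countable_rat]) (intro ballI AE_lim)
  then show ?thesis
  proof eventually_elim
    case (elim \<omega>)
    \<comment> \<open>The index is shifted since for \<open>n = 0\<close> the empirical measure is the zero measure.\<close>
    have "(\<lambda>n. kantorovich (log_empirical_measure (\<lambda>k \<omega>. u (X k \<omega>)) (Suc n) \<omega>) G) \<longlonglongrightarrow> 0"
    proof (rule kantorovich_tendsto_zero_if_potentials)
      show "real_distribution (log_empirical_measure (\<lambda>k \<omega>. u (X k \<omega>)) (Suc n) \<omega>)" for n
        by (rule real_distribution_log_empirical_measure) simp
      show "integrable (log_empirical_measure (\<lambda>k \<omega>. u (X k \<omega>)) (Suc n) \<omega>) (\<lambda>x. \<bar>x\<bar>)" for n
        by (rule log_empirical_measure_integral(1)) simp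
      show "real_distribution G"
        unfolding G_def real_distribution_def real_distribution_axioms_def
        using prob_space_normal_density[OF \<sigma>] by simp
      show "integrable G (\<lambda>x. \<bar>x\<bar>)"
        unfolding G_def using integrable_normal_moment_abs[OF \<sigma>, of 0 1] by (subst integrable_density) auto
      show "(\<lambda>n. \<integral>x. \<bar>x - a\<bar> \<partial>log_empirical_measure (\<lambda>k \<omega>. u (X k \<omega>)) (Suc n) \<omega>) \<longlonglongrightarrow> (\<integral>x. \<bar>x - a\<bar> \<partial>G)"
        if "a \<in> \<rat>" for a
        using elim that by (intro LIMSEQ_Suc) blast
    qed
    then show ?case unfolding G_def by (rule LIMSEQ_imp_Suc)
  qed
qed

end
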